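(* Let $G=SU(2)$, $G^{\mathbb C}=SL(2,\mathbb C)$, and for $t>0$, $g,g'\in G^{\mathbb C}$ let $$i^t(g,g')=\frac{|\langle\psi^t_g,\psi^t_{g'}\rangle|^2}{\|\psi^t_g\|^2\,\|\psi^t_{g'}\|^2}$$ be the overlap function of the coherent states $\psi^t_g,\psi^t_{g'}$. Then $i^t(g,g')$ approaches, exponentially fast with $t\to0$, the function $$p^t(g,(g')^\star)\,\frac{\pi t^3}{2},$$ where $p^t(g,g')$ denotes the probability density to find the system at the phase space point $g'$ in the state $\hat U_t\psi^t_g$ with respect to the Liouville measure on the phase space $T^*G$, that is, $$p^t(g,g')=\nu_t(g')\,\frac{|(\hat U_t\psi^t_g)(g')|^2}{\|\psi^t_g\|^2}.$$
   Context: $\psi^t_g(h)=\sum_{j=0,\frac12,1,\dots}(2j+1)e^{-\frac t2j(j+1)}\chi_j(gh^{-1})$ for $h\in SU(2)$, $g\in SL(2,\mathbb C)$, with $\chi_j$ the spin-$j$ character extended holomorphically to $SL(2,\mathbb C)$. Inner products and norms are those of $L_2(SU(2),d\mu_H)$, with $\mu_H$ the normalized Haar measure. The coherent state transform is $(\hat U_tf)(g)=\langle\overline{\psi^t_g},f\rangle=\int_Gd\mu_H(h)\,\psi^t_g(h)f(h)$. Every $g\in SL(2,\mathbb C)$ has a polar decomposition $g=Hu$ with $u\in SU(2)$ and $H=\exp(-ip^j\tau_j/2)$, $\vec p\in\mathbb R^3$, $p=|\vec p|$, $\tau_j=-i\sigma_j$ ($\sigma_j$ the Pauli matrices); this identifies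 $G^{\mathbb C}$ with $T^*G$, on which the Liouville measure is $d\Omega=d\mu_H(u)\,d^3p$. The function $$\nu_t(g)=\frac{2\sqrt2\,e^{-t/4}}{(2\pi t)^{3/2}}\,\frac{\sinh p}{p}\,e^{-p^2/t}$$ is the density with respect to $d\Omega$ of the measure $d\nu_t=\nu_t\,d\Omega$ on $G^{\mathbb C}$ for which $\hat U_t$ is a unitary map from $L_2(G,d\mu_H)$ onto the space of $\nu_t$-square-integrable holomorphic functions on $G^{\mathbb C}$. The involution is $g^\star=(g^{-1})^\dagger$, i.e. $g^\star=H^{-1}u$ for $g=Hu$. *)

theory Defs
  imports "HOL-Analysis.Analysis" "HOL-Computational_Algebra.Polynomial"
begin

type_synonym cmat2 = "complex^2^2"

definition dagger :: "cmat2 \<Rightarrow> cmat2" where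
  "dagger A = map_matrix cnj (transpose A)"

definition SL2C :: "cmat2 set" where
  "SL2C = {g. det g = 1}"

definition SU2 :: "cmat2 set" where
  "SU2 = {u. u ** dagger u = mat 1 \<and> det u = 1}"

definition involution :: "cmat2 \<Rightarrow> cmat2" where
  "involution g = dagger (matrix_inv g)"

text \<open>The invariance condition is left invariance; on a compact group right invariance follows.\<close>

definition normalized_Haar_SU2 :: "cmat2 measure \<Rightarrow> bool" where
  "normalized_Haar_SU2 \<mu> \<longleftrightarrow>
     sets \<mu> = sets (restrict_space borel SU2) \<and>
     emeasure \<mu> SU2 = 1 \<and>
     (\<forall>u\<in>SU2. distr \<mu> \<mu> (\<lambda>h. u ** h) = \<mu>)"

text \<open>
  The spin \<open>n / 2\<close> representation acts on homogeneous polynomials of degree \<open>n\<close> in two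
  variables by \<open>(\<pi>(g) f)(x, y) = f ((x, y) g)\<close>. In the basis \<open>x^(n-k) y^k\<close>, column \<open>k\<close> of
  \<open>\<pi>(g)\<close> consists of the coefficients of
  \<open>(g11 x + g21 y)^(n-k) (g12 x + g22 y)^k\<close>; below \<open>x\<close> is set to 1. The entries are polynomial
  in those of \<open>g\<close>, so the same formula is the holomorphic extension to $SL(2,\mathbb{C})$.
\<close>

definition spin_rep :: "nat \<Rightarrow> cmat2 \<Rightarrow> nat \<Rightarrow> nat \<Rightarrow> complex" where
  "spin_rep n g l k =
     coeff ([:g$1$1, g$2$1:] ^ (n - k) * [:g$1$2, g$2$2:] ^ k) l"

text \<open>The first argument of the character is \<open>n = 2 j\<close>.\<close>

definition spin_char :: "nat \<Rightarrow> cmat2 \<Rightarrow> complex" where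
  "spin_char n g = (\<Sum>k\<le>n. spin_rep n g k k)"

definition coherent_state :: "real \<Rightarrow> cmat2 \<Rightarrow> cmat2 \<Rightarrow> complex" where
  "coherent_state t g h =
     (\<Sum>n. let j = real n / 2 in
        of_real ((2 * j + 1) * exp (- t / 2 * j * (j + 1))) * spin_char n (g ** matrix_inv h))"

definition L2_inner :: "cmat2 measure \<Rightarrow> (cmat2 \<Rightarrow> complex) \<Rightarrow> (cmat2 \<Rightarrow> complex) \<Rightarrow> complex" where
  "L2_inner \<mu> f1 f2 = (\<integral>h. cnj (f1 h) * f2 h \<partial>\<mu>)"

definition L2_norm :: "cmat2 measure \<Rightarrow> (cmat2 \<Rightarrow> complex) \<Rightarrow> real" where
  "L2_norm \<mu> f = sqrt (\<integral>h. (cmod (f h))\<^sup>2 \<partial>\<mu>)"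

definition cs_transform :: "cmat2 measure \<Rightarrow> real \<Rightarrow> (cmat2 \<Rightarrow> complex) \<Rightarrow> cmat2 \<Rightarrow> complex" where
  "cs_transform \<mu> t f g = L2_inner \<mu> (\<lambda>h. cnj (coherent_state t g h)) f"

definition overlap :: "cmat2 measure \<Rightarrow> real \<Rightarrow> cmat2 \<Rightarrow> cmat2 \<Rightarrow> real" where
  "overlap \<mu> t g g' =
     (cmod (L2_inner \<mu> (coherent_state t g) (coherent_state t g')))\<^sup>2 /
     ((L2_norm \<mu> (coherent_state t g))\<^sup>2 * (L2_norm \<mu> (coherent_state t g'))\<^sup>2)"

definition pauli :: "cmat2 ^ 3" where
  "pauli = vector [vector [vector [0, 1], vector [1, 0]],
                   vector [vector [0, - \<i>], vector [\<i>, 0]],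
                   vector [vector [1, 0], vector [0, - 1]]]"

text \<open>\<^term>\<open>mat c ** A\<close> is the scalar multiple of the matrix \<open>A\<close> by the complex number \<open>c\<close>.\<close>

definition tau :: "3 \<Rightarrow> cmat2" where
  "tau j = mat (- \<i>) ** pauli $ j"

text \<open>
  The library's multiplication and powers on \<^typ>\<open>cmat2\<close> are componentwise, so matrix powers
  are iterates of \<open>(**)\<close>.
\<close>

definition mat_exp :: "cmat2 \<Rightarrow> cmat2" where
  "mat_exp A = (\<Sum>n. (1 / fact n) *\<^sub>R ((\<lambda>B. A ** B) ^^ n) (mat 1))"

definition boost :: "real ^ 3 \<Rightarrow> cmat2" where
  "boost p = mat_exp (\<Sum>j\<in>UNIV. mat (- \<i> * of_real (p $ j) / 2) ** tau j)"

text \<open>The vector \<open>p\<close> in the polar decomposition \<open>g = H u\<close>; unique for \<open>g\<close> in $SL(2,\mathbb{C})$.\<close>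

definition momentum :: "cmat2 \<Rightarrow> real ^ 3" where
  "momentum g = (THE p. \<exists>u\<in>SU2. g = boost p ** u)"

text \<open>The continuous function \<open>sinh p / p\<close>, which needs its value at 0 because \<open>0 / 0 = 0\<close> in HOL.\<close>

definition sinhc :: "real \<Rightarrow> real" where
  "sinhc p = (if p = 0 then 1 else sinh p / p)"

definition nu :: "real \<Rightarrow> cmat2 \<Rightarrow> real" where
  "nu t g = (let p = norm (momentum g) in
     2 * sqrt 2 * exp (- t / 4) / (2 * pi * t) powr (3 / 2) * sinhc p * exp (- p\<^sup>2 / t))"

definition phase_density :: "cmat2 measure \<Rightarrow> real \<Rightarrow> cmat2 \<Rightarrow> cmat2 \<Rightarrow> real" where
  "phase_density \<mu> t g g' =
     nu t g' * (cmod (cs_transform \<mu> t (coherent_state t g) g'))\<^sup>2 /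
     (L2_norm \<mu> (coherent_state t g))\<^sup>2"

end

theory Submission
  imports Defs "HOL-Probability.Characteristic_Functions"
begin

text \<open>
  By Schur orthogonality and \<open>\<chi> (A\<^sup>-\<^sup>1) = \<chi> A\<close>, both the inner product of \<open>\<psi>\<^sub>g\<close> and \<open>\<psi>\<^sub>h\<close> and the
  transform of \<open>\<psi>\<^sub>g\<close> at the involution of \<open>h\<close> are values of one central series with real
  coefficients, at complex conjugate traces, so their moduli agree. Hence the difference to be
  estimated is the overlap times \<open>1 - \<nu> \<parallel>\<psi>\<^sub>h\<parallel>\<^sup>2 \<pi> t\<^sup>3 / 2\<close>, with the density \<open>\<nu>\<close> taken at \<open>h\<close>. For \<open>h\<close> of
  momentum \<open>p\<close> the squared norm is \<open>e\<^bsup>t/4\<^esup> (\<Sum>m\<ge>1. m e\<^bsup>- t m\<^sup>2 / 4\<^esup> sinh (m p)) / sinh p\<close>, where the sum is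
  half the derivative of a theta function in \<open>p\<close>. Poisson summation turns it into a leading term, which cancels
  against \<open>\<nu>\<close>, times a factor \<open>1 + O(e\<^bsup>- 2 \<pi>\<^sup>2 / t\<^esup>)\<close> that is uniform in \<open>p\<close>.
\<close>

section \<open>Spin representations and their characters\<close>

text \<open>On matrices of determinant 1 the character depends on the trace alone, through the
  recursion \<open>cheb\<close>; so summability, conjugation symmetry and the values at boosts are
  questions about one scalar series. The obstacle is uniformity in p: the sum to be estimated grows
  like exp (p^2 / t), so only its ratio to the leading term can be controlled, and the quotient sinh
  (m p) / p must be kept together down to p = 0, where the estimate is obtained as a limit. With s =
  t / 4 the dual Gaussians are exp (- 4 pi^2 k^2 / t). Differentiating in p and bounding the sine
  brings down a factor of order k^2 / t; half of the exponent is spent on absorbing it, hence the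
  rate 2 pi^2 / t.\<close>

definition mat2 :: "complex \<Rightarrow> complex \<Rightarrow> complex \<Rightarrow> complex \<Rightarrow> cmat2" where
  "mat2 a b c d = vector [vector [a, b], vector [c, d]]"

lemma mat2_component [simp]:
  "mat2 a b c d $ 1 $ 1 = a" "mat2 a b c d $ 1 $ 2 = b"
  "mat2 a b c d $ 2 $ 1 = c" "mat2 a b c d $ 2 $ 2 = d"
  by (simp_all add: mat2_def)

lemma mat2_eq_iff: "A = B \<longleftrightarrow> A$1$1 = B$1$1 \<and> A$1$2 = B$1$2 \<and> A$2$1 = B$2$1 \<and> A$2$2 = (B$2$2 :: complex)"
  for A B :: cmat2
  by (auto simp: vec_eq_iff forall_2)

lemma mult_component2:
  "(A ** B) $ i $ j = A$i$1 * B$1$j + A$i$2 * B$2$j" for A B :: cmat2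
  by (simp add: matrix_matrix_mult_def sum_2)

lemma mat1_component2 [simp]:
  "(mat c :: cmat2) $ 1 $ 1 = c" "(mat c :: cmat2) $ 1 $ 2 = 0"
  "(mat c :: cmat2) $ 2 $ 1 = 0" "(mat c :: cmat2) $ 2 $ 2 = c"
  by (simp_all add: mat_def)

lemma trace2: "trace A = A$1$1 + A$2$2" for A :: cmat2
  by (simp add: trace_def sum_2)

text \<open>Substitution in two variables: \<open>p\<close> stands for a form of degree
  \<open>n\<close> with its first variable set to 1, and \<open>homog\<close> evaluates that form at
  the pair (X, Y).\<close>

definition homog :: "nat \<Rightarrow> complex poly \<Rightarrow> complex poly \<Rightarrow> complex poly \<Rightarrow> complex poly" where
  "homog n p X Y = (\<Sum>i\<le>n. smult (coeff p i) (X ^ (n - i) * Y ^ i))"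

lemma homog_linear_mult:
  assumes "degree p \<le> n"
  shows "homog (Suc n) ([:c, d:] * p) X Y = (smult c X + smult d Y) * homog n p X Y"
proof -
  have c: "coeff ([:c, d:] * p) i = c * coeff p i + d * (case i of 0 \<Rightarrow> 0 | Suc j \<Rightarrow> coeff p j)" for i
    by (simp add: coeff_pCons split: nat.split)
  have "homog (Suc n) ([:c, d:] * p) X Y
      = (\<Sum>i\<le>Suc n. smult (c * coeff p i) (X ^ (Suc n - i) * Y ^ i))
      + (\<Sum>i\<le>Suc n. smult (d * (case i of 0 \<Rightarrow> 0 | Suc j \<Rightarrow> coeff p j)) (X ^ (Suc n - i) * Y ^ i))"
    unfolding homog_def c by (simp only: smult_add_left sum.distrib)
  \<comment> \<open>The degree bound kills the term i = n + 1; on the remaining ones truncated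
    subtraction is exact.\<close>
  also have "(\<Sum>i\<le>Suc n. smult (c * coeff p i) (X ^ (Suc n - i) * Y ^ i))
      = (\<Sum>i\<le>n. smult (c * coeff p i) (X ^ (Suc n - i) * Y ^ i))"
    using assms by (simp add: coeff_eq_0)
  also have "\<dots> = smult c X * homog n p X Y"
    unfolding homog_def sum_distrib_left
    by (rule sum.cong) (simp_all add: Suc_diff_le algebra_simps)
  also have "(\<Sum>i\<le>Suc n. smult (d * (case i of 0 \<Rightarrow> 0 | Suc j \<Rightarrow> coeff p j)) (X ^ (Suc n - i) * Y ^ i))
      = smult d Y * homog n p X Y"
    unfolding sum.atMost_Suc_shift homog_def sum_distrib_left
    by (simp add: algebra_simps)
  finally show ?thesis by (simp add: algebra_simps)
qed

lemma degree_linear_power_le: "degree ([:a, b:] ^ m :: complex poly) \<le> m"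
  using degree_power_le[of "[:a, b:]" m] by (simp split: if_splits)

lemma degree_linear_powers_le:
  "degree ([:a, b:] ^ m * [:c, d:] ^ k :: complex poly) \<le> m + k"
  by (rule order_trans[OF degree_mult_le add_mono]) (rule degree_linear_power_le)+

lemma homog_linear_powers:
  "homog (m + k) ([:a, b:] ^ m * [:c, d:] ^ k) X Y =
    (smult a X + smult b Y) ^ m * (smult c X + smult d Y) ^ k"
proof (induction m)
  case 0
  show ?case
  proof (induction k)
    case 0
    show ?case by (simp add: homog_def)
  next
    case (Suc k)
    show ?case
      using homog_linear_mult[of "[:c, d:] ^ k" k c d X Y] Suc
      by (simp add: degree_linear_power_le)
  qed
next
  case (Suc m)
  show ?case
    using homog_linear_mult[of "[:a, b:] ^ m * [:c, d:] ^ k" "m + k" a b X Y] Suc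
    by (simp only: power_Suc add_Suc mult.assoc degree_linear_powers_le)
qed

text \<open>Column \<open>k\<close> for \<open>A ** B\<close> arises from column \<open>k\<close>
  for \<open>B\<close> by replacing the two variables with the linear forms given by the columns of
  \<open>A\<close>; expanding that substitution in monomials is the matrix product.\<close>

lemma spin_rep_mult:
  assumes "k \<le> n"
  shows "spin_rep n (A ** B) l k = (\<Sum>i\<le>n. spin_rep n A l i * spin_rep n B i k)"
proof -
  have "spin_rep n (A ** B) l k = coeff (homog n ([:B$1$1, B$2$1:] ^ (n - k) * [:B$1$2, B$2$2:] ^ k)
          [:A$1$1, A$2$1:] [:A$1$2, A$2$2:]) l"
    using homog_linear_powers[of "n - k" k "B$1$1" "B$2$1" "B$1$2" "B$2$2" "[:A$1$1, A$2$1:]" "[:A$1$2, A$2$2:]"] assms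
    by (simp add: spin_rep_def mult_component2 ac_simps)
  then show ?thesis
    by (simp add: homog_def coeff_sum spin_rep_def mult.commute)
qed

lemma spin_rep_mat1: "spin_rep n (mat 1) l k = (if l = k then 1 else 0)"
proof -
  have "[:0, 1:] ^ k = (monom 1 k :: complex poly)"
    by (simp add: monom_altdef)
  then show ?thesis
    by (simp add: spin_rep_def flip: one_pCons)
qed

lemma spin_char_commute: "spin_char n (A ** B) = spin_char n (B ** A)"
proof -
  have "spin_char n (A ** B) = (\<Sum>k\<le>n. \<Sum>i\<le>n. spin_rep n A k i * spin_rep n B i k)" for A B
    unfolding spin_char_def by (rule sum.cong) (simp_all add: spin_rep_mult)
  note this[of A B] this[of B A]
  moreover have "(\<Sum>k\<le>n. \<Sum>i\<le>n. spin_rep n A k i * spin_rep n B i k) =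
    (\<Sum>k\<le>n. \<Sum>i\<le>n. spin_rep n B k i * spin_rep n A i k)"
    by (subst sum.swap) (simp add: mult.commute)
  ultimately show ?thesis by simp
qed

lemma coeff_linear_power_top: "coeff ([:b, d:] ^ k) k = (d ^ k :: complex)"
proof (induction k)
  case (Suc k)
  then show ?case
    using degree_linear_power_le[of b d k] by (simp add: coeff_eq_0)
qed simp

text \<open>The first linear form is constant when the lower left entry vanishes, so the diagonal
  coefficient \<open>k\<close> picks the top coefficient of the second factor.\<close>

lemma spin_char_triangular:
  assumes "T $ 2 $ 1 = 0"
  shows "spin_char n T = (\<Sum>k\<le>n. T$1$1 ^ (n - k) * T$2$2 ^ k)"
  unfolding spin_char_def spin_rep_def assms
  by (rule sum.cong) (simp_all add: coeff_linear_power_top poly_const_pow)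

text \<open>The normalization is \<open>cheb n (2 * cos x) = sin ((n + 1) * x) / sin x\<close>.\<close>

fun cheb :: "nat \<Rightarrow> 'a::comm_ring_1 \<Rightarrow> 'a" where
  "cheb 0 x = 1"
| "cheb (Suc 0) x = x"
| "cheb (Suc (Suc n)) x = x * cheb (Suc n) x - cheb n x"

text \<open>The sums satisfy S (n + 1) = a S n + d^(n + 1); eliminating the power of
  \<open>d\<close> by means of a d = 1 leaves the three-term recursion.\<close>

lemma cheb_sum:
  fixes a d :: "'a::comm_ring_1"
  assumes "a * d = 1"
  shows "(\<Sum>k\<le>n. a ^ (n - k) * d ^ k) = cheb n (a + d)"
proof (induction n rule: induct_nat_012)
  case (ge2 n)
  define S where "S n = (\<Sum>k\<le>n. a ^ (n - k) * d ^ k)" for n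
  have 1: "S (Suc n) = a * S n + d ^ Suc n" for n
    by (simp add: S_def sum_distrib_left Suc_diff_le mult.assoc)
  have "S (Suc (Suc n)) = (a + d) * S (Suc n) - S n"
  proof -
    have "d * S (Suc n) = (a * d) * S n + d ^ Suc (Suc n)"
      using 1[of n] by (simp add: algebra_simps)
    then show ?thesis
      using 1[of "Suc n"] assms by (simp add: algebra_simps)
  qed
  with ge2 show ?case by (simp add: S_def)
qed (simp_all add: algebra_simps)

text \<open>Conjugation invariance reduces the claim to triangular matrices, where the character is
  a sum over powers of two mutually inverse eigenvalues.\<close>

lemma spin_char_eq_cheb:
  assumes "det A = 1"
  shows "spin_char n A = cheb n (trace A)"
proof (cases "A $ 2 $ 1 = 0")
  case True
  then show ?thesis
    using assms by (simp add: spin_char_triangular cheb_sum det_2 trace2)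
next
  case False
  \<comment> \<open>An eigenvalue of \<open>A\<close>, by the quadratic formula for the
    characteristic polynomial.\<close>
  define l where "l = (trace A + csqrt ((trace A)\<^sup>2 - 4)) / 2"
  have l: "l\<^sup>2 - trace A * l + 1 = 0"
    unfolding l_def by (simp add: power2_eq_square field_simps) (simp add: algebra_simps flip: power2_eq_square)
  \<comment> \<open>The first column of \<open>S\<close> is an eigenvector, so \<open>S\<close> conjugates \<open>A\<close> to triangular form.\<close>
  define S where "S = mat2 (l - A$2$2) 1 (A$2$1) 0"
  define S' where "S' = mat2 0 (1 / A$2$1) 1 (- (l - A$2$2) / A$2$1)"
  define T where "T = mat2 l 1 0 (trace A - l)"
  have SS': "S ** S' = mat 1" "S' ** S = mat 1"
    using False by (auto simp: mat2_eq_iff mult_component2 S_def S'_def field_simps)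
  have "A$1$1 * (l - A$2$2) + A$1$2 * A$2$1 = (l - A$2$2) * l"
    using l assms by (simp add: det_2 trace2 power2_eq_square algebra_simps)
  then have AS: "A ** S = S ** T"
    by (auto simp: mat2_eq_iff mult_component2 S_def T_def trace2 algebra_simps)
  have "spin_char n A = spin_char n ((A ** S) ** S')"
    by (simp add: SS' flip: matrix_mul_assoc)
  also have "\<dots> = spin_char n (S' ** (S ** T))"
    by (simp add: spin_char_commute AS)
  also have "\<dots> = spin_char n T"
    by (simp add: SS' matrix_mul_assoc)
  also have "\<dots> = cheb n (trace A)"
    using l by (simp add: spin_char_triangular T_def cheb_sum power2_eq_square algebra_simps)
  finally show ?thesis .
qed

section \<open>Polar decomposition\<close>

lemma dagger_component [simp]: "dagger A $ i $ j = cnj (A $ j $ i)"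
  by (simp add: dagger_def map_matrix_def transpose_def)

lemma dagger_mult: "dagger (A ** B) = dagger B ** dagger A"
  by (auto simp: mat2_eq_iff mult_component2)

lemma matrix_inv_SL2C:
  assumes "g \<in> SL2C"
  shows "matrix_inv g = mat2 (g$2$2) (- g$1$2) (- g$2$1) (g$1$1)"
proof -
  let ?a = "mat2 (g$2$2) (- g$1$2) (- g$2$1) (g$1$1)"
  have d: "g$1$1 * g$2$2 - g$1$2 * g$2$1 = 1"
    using assms by (simp add: SL2C_def det_2)
  have 1: "g ** ?a = mat 1" "?a ** g = mat 1"
    using d by (auto simp: mat2_eq_iff mult_component2 algebra_simps)
  have "matrix_inv g ** g = mat 1"
    using 1 unfolding matrix_inv_def by (rule_tac someI2[of _ ?a]) auto
  then have "matrix_inv g ** (g ** ?a) = ?a"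
    by (simp add: matrix_mul_assoc)
  then show ?thesis using 1 by simp
qed

definition pauli_vec :: "real ^ 3 \<Rightarrow> cmat2" where
  "pauli_vec p = mat2 (of_real (p$3)) (Complex (p$1) (- p$2)) (Complex (p$1) (p$2)) (- of_real (p$3))"

text \<open>For fixed \<open>p\<close> the matrices a + b (p . sigma) form a commutative algebra,
  since (p . sigma)^2 = |p|^2. Computing with boosts becomes arithmetic on the two real
  coefficients.\<close>

definition herm :: "real \<Rightarrow> real \<Rightarrow> real ^ 3 \<Rightarrow> cmat2" where
  "herm a b p = a *\<^sub>R mat 1 + b *\<^sub>R pauli_vec p"

lemma herm_component [simp]:
  "herm a b p $ 1 $ 1 = of_real (a + b * p$3)" "herm a b p $ 1 $ 2 = of_real b * Complex (p$1) (- p$2)"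
  "herm a b p $ 2 $ 1 = of_real b * Complex (p$1) (p$2)" "herm a b p $ 2 $ 2 = of_real (a - b * p$3)"
  by (simp_all add: herm_def pauli_vec_def scaleR_conv_of_real[where 'a = complex])

lemma norm3_sq: "(norm (p :: real^3))\<^sup>2 = (p$1)\<^sup>2 + (p$2)\<^sup>2 + (p$3)\<^sup>2"
  by (simp add: norm_vec_def L2_set_def sum_3 power2_eq_square)

lemma herm_mult:
  "herm a b p ** herm c d p = herm (a * c + b * d * (norm p)\<^sup>2) (a * d + b * c) p"
  unfolding norm3_sq
  by (auto simp: mat2_eq_iff mult_component2 complex_eq_iff algebra_simps power2_eq_square)

lemma det_herm: "det (herm a b p) = of_real (a\<^sup>2 - b\<^sup>2 * (norm p)\<^sup>2)"
  unfolding norm3_sq by (simp add: det_2 complex_eq_iff algebra_simps power2_eq_square)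

lemma trace_herm: "trace (herm a b p) = of_real (2 * a)"
  by (simp add: trace2)

lemma dagger_herm: "dagger (herm a b p) = herm a b p"
  by (auto simp: mat2_eq_iff complex_eq_iff)

lemma herm_eq_iff: "herm a b p = herm a b q \<longleftrightarrow> b = 0 \<or> p = q"
  by (auto simp: mat2_eq_iff complex_eq_iff vec_eq_iff forall_3)

section \<open>Closed form of the boosts\<close>

lemma sinhc_eq: "x * sinhc x = sinh x"
  by (simp add: sinhc_def)

lemma sinhc_pos: "sinhc x > 0"
  by (cases x "0::real" rule: linorder_cases) (auto simp: sinhc_def divide_neg_neg)

text \<open>The factor -i of the exponent and the one inside \<open>tau\<close> multiply to -1, so a
  boost is exp (- (p . sigma) / 2); this is the minus sign in all formulas below.\<close>

lemma boost_exponent: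
  "(\<Sum>j\<in>UNIV. mat (- \<i> * of_real (p $ j) / 2) ** tau j) = herm 0 (- 1 / 2) p"
  by (auto simp: mat2_eq_iff mult_component2 sum_3 tau_def pauli_def complex_eq_iff)

text \<open>The square of the exponent is scalar, so even powers are scalar and odd powers are
  multiples of the exponent; the exponential series splits accordingly into cosh and
  \<open>sinhc\<close>.\<close>

lemma herm_iterate:
  "((\<lambda>B. herm 0 (- 1 / 2) p ** B) ^^ n) (mat 1) =
    herm (if even n then (norm p / 2) ^ n else 0) (if even n then 0 else - ((norm p / 2) ^ (n - 1)) / 2) p"
proof (induction n)
  case (Suc n)
  show ?case
    unfolding funpow.simps comp_apply Suc herm_mult
    by (cases n) (auto simp: power2_eq_square mult_ac elim: oddE)
qed (auto simp: mat2_eq_iff)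

lemma sinhc_converges: "(\<lambda>n. if even n then 0 else x ^ (n - 1) / fact n) sums sinhc x" for x :: real
proof (cases "x = 0")
  case True
  \<comment> \<open>At 0 only n = 1 survives, through 0 ^ 0 = 1.\<close>
  have "(\<lambda>n. if even n then 0 else x ^ (n - 1) / fact n) = (\<lambda>n. if n = 1 then 1 else 0)"
    using True by (auto simp: fun_eq_iff power_0_left elim: oddE)
  then show ?thesis
    using sums_single[of 1 "\<lambda>_. 1::real"] True by (simp add: sinhc_def)
next
  case False
  have "(\<lambda>n. if even n then 0 else x ^ n / fact n) = (\<lambda>n. if even n then 0 else x ^ n /\<^sub>R fact n)"
    by (auto simp: fun_eq_iff divide_inverse)
  then have "(\<lambda>n. if even n then 0 else x ^ n / fact n) sums sinh x"
    using sinh_converges[of x] by (simp only:)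
  then have "(\<lambda>n. (if even n then 0 else x ^ n / fact n) / x) sums (sinh x / x)"
    by (rule sums_divide)
  also have "(\<lambda>n. (if even n then 0 else x ^ n / fact n) / x) = (\<lambda>n. if even n then 0 else x ^ (n - 1) / fact n)"
    using False by (auto simp: fun_eq_iff elim!: oddE)
  finally show ?thesis using False by (simp add: sinhc_def)
qed

lemma boost_eq: "boost p = herm (cosh (norm p / 2)) (- sinhc (norm p / 2) / 2) p"
proof -
  define x where "x = norm p / 2"
  have "(\<lambda>n. (if even n then x ^ n / fact n else 0)) sums cosh x"
    using cosh_converges[of x] by (simp add: divide_inverse mult.commute cong: if_cong)
  moreover have "(\<lambda>n. (- 1 / 2) * (if even n then 0 else x ^ (n - 1) / fact n)) sums ((- 1 / 2) * sinhc x)"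
    by (intro sums_mult sinhc_converges)
  ultimately have "(\<lambda>n. (if even n then x ^ n / fact n else 0) *\<^sub>R mat 1 +
      ((- 1 / 2) * (if even n then 0 else x ^ (n - 1) / fact n)) *\<^sub>R pauli_vec p) sums herm (cosh x) ((- 1 / 2) * sinhc x) p"
    unfolding herm_def by (intro sums_add sums_scaleR_left)
  also have "(\<lambda>n. (if even n then x ^ n / fact n else 0) *\<^sub>R mat 1 +
      ((- 1 / 2) * (if even n then 0 else x ^ (n - 1) / fact n)) *\<^sub>R pauli_vec p) =
     (\<lambda>n. (1 / fact n) *\<^sub>R ((\<lambda>B. herm 0 (- 1 / 2) p ** B) ^^ n) (mat 1))"
    unfolding herm_iterate by (auto simp: fun_eq_iff herm_def x_def scaleR_add_right)
  finally show ?thesis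
    unfolding boost_def mat_exp_def boost_exponent x_def by (simp add: sums_iff)
qed

lemma boost_squared: "boost p ** boost p = herm (cosh (norm p)) (- sinhc (norm p)) p"
proof -
  define x where "x = norm p / 2"
  have n: "norm p = 2 * x" by (simp add: x_def)
  have 1: "cosh x * cosh x + - sinhc x / 2 * (- sinhc x / 2) * (2 * x)\<^sup>2 = cosh (2 * x)"
    unfolding cosh_double sinhc_eq[symmetric] by (simp add: power2_eq_square)
  have 2: "cosh x * (- sinhc x / 2) + - sinhc x / 2 * cosh x = - sinhc (2 * x)"
    by (simp add: sinhc_def sinh_double)
  show ?thesis
    unfolding boost_eq herm_mult x_def[symmetric] unfolding n 1 2 ..
qed

lemma boost_uminus_mult: "boost (- p) ** boost p = mat 1" "boost p ** boost (- p) = mat 1"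
proof -
  have neg: "herm a b (- p) = herm a (- b) p" for a b
    by (auto simp: mat2_eq_iff complex_eq_iff)
  define x where "x = norm p / 2"
  have n: "norm p = 2 * x" by (simp add: x_def)
  have 1: "cosh x * cosh x - sinhc x / 2 * (sinhc x / 2) * (2 * x)\<^sup>2 = 1"
    using cosh_square_eq[of x] unfolding sinhc_eq[symmetric] by (simp add: power2_eq_square)
  have "herm 1 0 p = mat 1" by (auto simp: mat2_eq_iff)
  then show "boost (- p) ** boost p = mat 1" "boost p ** boost (- p) = mat 1"
    using 1 unfolding boost_eq norm_minus_cancel neg herm_mult x_def[symmetric] unfolding n by simp_all
qed

lemma det_boost: "det (boost p) = 1"
proof -
  define x where "x = norm p / 2"
  have n: "norm p = 2 * x" by (simp add: x_def)
  have 1: "(cosh x)\<^sup>2 - (- sinhc x / 2)\<^sup>2 * (2 * x)\<^sup>2 = 1"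
    using cosh_square_eq[of x] unfolding sinhc_eq[symmetric] by (simp add: power2_eq_square)
  show ?thesis
    unfolding boost_eq det_herm x_def[symmetric] unfolding n 1 by simp
qed

lemma dagger_boost: "dagger (boost p) = boost p"
  by (simp add: boost_eq dagger_herm)

lemma cosh_real_inj: "cosh x = cosh y \<longleftrightarrow> x = y" if "x \<ge> 0" "y \<ge> 0" for x y :: real
  using cosh_real_strict_mono[of x y] cosh_real_strict_mono[of y x] that
  by (cases x y rule: linorder_cases) auto

text \<open>The unitary factor cancels and the squared boost remains; its trace gives the norm of
  \<open>p\<close>, its traceless part the direction.\<close>

lemma polar_gram:
  assumes "u \<in> SU2"
  shows "(boost p ** u) ** dagger (boost p ** u) = herm (cosh (norm p)) (- sinhc (norm p)) p"
proof -
  have "(boost p ** u) ** dagger (boost p ** u) = boost p ** (u ** dagger u) ** boost p"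
    by (simp add: dagger_mult dagger_boost matrix_mul_assoc)
  with assms show ?thesis by (simp add: SU2_def boost_squared)
qed

lemma polar_unique:
  assumes "boost p ** u = boost q ** v" "u \<in> SU2" "v \<in> SU2"
  shows "p = q"
proof -
  have eq: "herm (cosh (norm p)) (- sinhc (norm p)) p = herm (cosh (norm q)) (- sinhc (norm q)) q"
    using polar_gram[of u p] polar_gram[of v q] assms by simp
  from arg_cong[OF this, of trace] have "cosh (norm p) = cosh (norm q)"
    by (simp add: trace_herm)
  then have "norm p = norm q" by (simp add: cosh_real_inj)
  with eq show ?thesis using sinhc_pos[of "norm q"] by (simp add: herm_eq_iff)
qed

text \<open>The Gram matrix \<open>P\<close> of \<open>g\<close> is hermitian with determinant 1 and
  nonnegative diagonal, so it can be solved for \<open>p\<close> as a squared boost; removing that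
  boost from \<open>g\<close> leaves a unitary matrix.\<close>

lemma polar_exists:
  assumes "g \<in> SL2C"
  shows "\<exists>p. \<exists>u\<in>SU2. g = boost p ** u"
proof -
  define P where "P = g ** dagger g"
  define a where "a = (cmod (g$1$1))\<^sup>2 + (cmod (g$1$2))\<^sup>2"
  define d where "d = (cmod (g$2$1))\<^sup>2 + (cmod (g$2$2))\<^sup>2"
  define b where "b = P $ 1 $ 2"
  have P: "P $ 1 $ 1 = of_real a" "P $ 2 $ 2 = of_real d" "P $ 2 $ 1 = cnj b"
    by (simp_all add: P_def a_def d_def b_def mult_component2 complex_norm_square[symmetric] mult.commute)
  have detg: "det g = 1" using assms by (simp add: SL2C_def)
  have "det P = 1"
  proof -
    have "det (dagger g) = cnj (det g)" by (simp add: det_2)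
    then show ?thesis using detg by (simp add: P_def det_mul)
  qed
  then have "of_real (a * d) - b * cnj b = 1"
    by (simp add: det_2 P b_def[symmetric])
  then have "complex_of_real (a * d - (cmod b)\<^sup>2) = of_real 1"
    by (simp add: complex_norm_square[symmetric])
  then have ad: "a * d - (cmod b)\<^sup>2 = 1"
    by (simp only: of_real_eq_iff)
  have nonneg: "a \<ge> 0" "d \<ge> 0" by (auto simp: a_def d_def)
  \<comment> \<open>This is det P = 1 in terms of half the trace; it puts half the trace into the
    range of cosh.\<close>
  have "((a + d) / 2)\<^sup>2 = ((a - d) / 2)\<^sup>2 + (cmod b)\<^sup>2 + 1"
    using ad by (simp add: power2_eq_square field_simps)
  then have sq: "((a + d) / 2)\<^sup>2 - 1 = ((a - d) / 2)\<^sup>2 + (cmod b)\<^sup>2" by simp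
  have "0 \<le> ((a + d) / 2)\<^sup>2 - 1"
    unfolding sq by (intro add_nonneg_nonneg) simp_all
  then have "1\<^sup>2 \<le> ((a + d) / 2)\<^sup>2" by simp
  then have ge1: "1 \<le> (a + d) / 2"
    using nonneg by (intro power2_le_imp_le[of 1]) auto
  define r where "r = arcosh ((a + d) / 2)"
  have r: "r \<ge> 0" "cosh r = (a + d) / 2"
    using ge1 by (simp_all add: r_def cosh_arcosh_real)
  define k where "k = sinhc r"
  have k: "k > 0" by (simp add: k_def sinhc_pos)
  \<comment> \<open>Read off from \<open>boost_squared\<close>: \<open>b\<close> has to be - k (p1 -
    i p2), and a - d has to be - 2 k p3.\<close>
  define p :: "real^3" where "p = vector [- Re b / k, Im b / k, - (a - d) / (2 * k)]"
  have pc: "p$1 = - Re b / k" "p$2 = Im b / k" "p$3 = - (a - d) / (2 * k)"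
    by (simp_all add: p_def vector_3)
  have "(norm p)\<^sup>2 * k\<^sup>2 = ((a - d) / 2)\<^sup>2 + (cmod b)\<^sup>2"
    unfolding norm3_sq pc cmod_power2 using k by (simp add: power_divide power2_commute[of a d] field_simps)
  also have "\<dots> = (cosh r)\<^sup>2 - 1" by (simp only: r(2) sq)
  also have "\<dots> = r\<^sup>2 * k\<^sup>2"
    using cosh_square_eq[of r] by (simp add: k_def power_mult_distrib[symmetric] sinhc_eq)
  finally have "norm p = r"
    using k r by (simp add: power2_eq_iff_nonneg)
  then have P_eq: "boost p ** boost p = P"
    unfolding boost_squared using r k P
    by (auto simp: mat2_eq_iff complex_eq_iff k_def[symmetric] pc b_def[symmetric] field_simps)
  define u where "u = boost (- p) ** g"
  have "g = boost p ** u"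
    by (simp add: u_def matrix_mul_assoc boost_uminus_mult)
  moreover have "u ** dagger u = mat 1"
  proof -
    have "u ** dagger u = boost (- p) ** P ** boost (- p)"
      by (simp add: u_def P_def dagger_mult dagger_boost matrix_mul_assoc)
    also have "\<dots> = (boost (- p) ** boost p) ** (boost p ** boost (- p))"
      by (simp only: P_eq[symmetric] matrix_mul_assoc)
    finally show ?thesis by (simp add: boost_uminus_mult)
  qed
  moreover have "det u = 1"
    using detg by (simp add: u_def det_mul det_boost)
  ultimately show ?thesis by (auto simp: SU2_def)
qed

text \<open>Disposes of the definite description: later arguments reach the norm of
  \<open>momentum\<close> through this trace.\<close>

lemma trace_gram:
  assumes "g \<in> SL2C"
  shows "trace (g ** dagger g) = of_real (2 * cosh (norm (momentum g)))"
proof -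
  have "\<exists>!p. \<exists>u\<in>SU2. g = boost p ** u"
    using polar_exists[OF assms] polar_unique by metis
  from theI'[OF this] obtain u where u: "u \<in> SU2" "g = boost (momentum g) ** u"
    unfolding momentum_def by blast
  from polar_gram[OF u(1), of "momentum g"] show ?thesis
    unfolding u(2)[symmetric] by (simp add: trace_herm)
qed

text \<open>The trace of the Gram matrix is the sum of the squared moduli of the entries, and the
  involution only permutes, conjugates and negates entries.\<close>

lemma involution_SL2C:
  assumes "g \<in> SL2C"
  shows "involution g \<in> SL2C" "norm (momentum (involution g)) = norm (momentum g)"
proof -
  have inv: "involution g = mat2 (cnj (g$2$2)) (- cnj (g$2$1)) (- cnj (g$1$2)) (cnj (g$1$1))"
    unfolding involution_def matrix_inv_SL2C[OF assms] by (auto simp: mat2_eq_iff)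
  have "det (involution g) = cnj (det g)"
    by (simp add: inv det_2 algebra_simps)
  with assms show *: "involution g \<in> SL2C"
    by (simp add: SL2C_def)
  have "trace (involution g ** dagger (involution g)) = trace (g ** dagger g)"
    by (simp add: inv trace2 mult_component2 algebra_simps)
  then have "cosh (norm (momentum (involution g))) = cosh (norm (momentum g))"
    by (simp add: trace_gram assms *)
  then show "norm (momentum (involution g)) = norm (momentum g)"
    by (simp add: cosh_real_inj)
qed

section \<open>Orthogonality relations on SU(2)\<close>

lemma SU2_left_inverse: "u \<in> SU2 \<Longrightarrow> dagger u ** u = mat 1"
  by (auto simp: SU2_def matrix_left_right_inverse)

lemma SU2_subset_SL2C: "SU2 \<subseteq> SL2C"
  by (auto simp: SU2_def SL2C_def)

lemma SU2_mult: "u \<in> SU2 \<Longrightarrow> v \<in> SU2 \<Longrightarrow> u ** v \<in> SU2"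
proof -
  assume uv: "u \<in> SU2" "v \<in> SU2"
  have "(u ** v) ** dagger (u ** v) = u ** (v ** dagger v) ** dagger u"
    by (simp add: dagger_mult matrix_mul_assoc)
  with uv show "u ** v \<in> SU2" by (simp add: SU2_def det_mul)
qed

lemma matrix_inv_SU2: "u \<in> SU2 \<Longrightarrow> matrix_inv u = dagger u"
proof -
  assume u: "u \<in> SU2"
  have "matrix_inv u ** u = mat 1"
    using u SU2_left_inverse[OF u] unfolding matrix_inv_def
    by (rule_tac someI2[of _ "dagger u"]) (auto simp: SU2_def)
  then have "matrix_inv u ** (u ** dagger u) = dagger u"
    by (simp add: matrix_mul_assoc)
  with u show ?thesis by (simp add: SU2_def)
qed

section \<open>Continuity and compactness for integration over SU(2)\<close>

lemma continuous_on_dagger [continuous_intros]: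
  "continuous_on S f \<Longrightarrow> continuous_on S (\<lambda>x. dagger (f x))"
  unfolding dagger_def map_matrix_def transpose_def by (simp add: continuous_intros)

lemma continuous_on_matrix_mult2 [continuous_intros]:
  fixes f g :: "'a::topological_space \<Rightarrow> cmat2"
  shows "continuous_on S f \<Longrightarrow> continuous_on S g \<Longrightarrow> continuous_on S (\<lambda>x. f x ** g x)"
  unfolding matrix_matrix_mult_def by (intro continuous_intros)

lemma continuous_on_trace2 [continuous_intros]:
  fixes f :: "'a::topological_space \<Rightarrow> cmat2"
  shows "continuous_on S f \<Longrightarrow> continuous_on S (\<lambda>x. trace (f x))"
  unfolding trace_def by (intro continuous_intros)

lemma continuous_on_coeff_mult:
  fixes P Q :: "'a::topological_space \<Rightarrow> complex poly"
  assumes "\<And>l. continuous_on S (\<lambda>x. coeff (P x) l)" "\<And>l. continuous_on S (\<lambda>x. coeff (Q x) l)"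
  shows "continuous_on S (\<lambda>x. coeff (P x * Q x) l)"
  unfolding coeff_mult by (intro continuous_intros assms)

lemma continuous_on_coeff_linear_power:
  fixes f g :: "'a::topological_space \<Rightarrow> complex"
  assumes "continuous_on S f" "continuous_on S g"
  shows "continuous_on S (\<lambda>x. coeff ([:f x, g x:] ^ m) l)"
proof (induction m arbitrary: l)
  case (Suc m)
  have "coeff [:a, b:] l = (if l = 0 then a else if l = 1 then b else 0)" for a b :: complex and l
    by (auto simp: coeff_pCons split: nat.split)
  then have "continuous_on S (\<lambda>x. coeff [:f x, g x:] l)" for l
    using assms by (cases "l = 0"; cases "l = 1") simp_all
  then show ?case
    unfolding power_Suc by (intro continuous_on_coeff_mult Suc)
qed simp

lemma continuous_on_spin_rep [continuous_intros]:
  "continuous_on S f \<Longrightarrow> continuous_on S (\<lambda>x. spin_rep n (f x) l k)"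
  unfolding spin_rep_def
  by (intro continuous_on_coeff_mult continuous_on_coeff_linear_power continuous_intros)

lemma norm_SU2_le: "u \<in> SU2 \<Longrightarrow> norm u \<le> 2"
proof -
  assume u: "u \<in> SU2"
  then have 1: "(u ** dagger u) $ i $ i = 1" for i
    using exhaust_2[of i] by (auto simp: SU2_def)
  have "(norm (u $ i))\<^sup>2 = 1" for i
  proof -
    have "complex_of_real ((norm (u $ i))\<^sup>2) = (u ** dagger u) $ i $ i"
      by (simp add: norm_vec_def L2_set_def sum_2 mult_component2 complex_norm_square[symmetric])
    then show ?thesis unfolding 1 by (simp only: of_real_eq_1_iff)
  qed
  then have "(norm u)\<^sup>2 = 2"
    by (simp add: norm_vec_def[of u] L2_set_def)
  then have "(norm u)\<^sup>2 \<le> 2\<^sup>2" by simp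
  then show "norm u \<le> 2" by (rule power2_le_imp_le) simp
qed

lemma compact_SU2: "compact SU2"
proof -
  have "bounded SU2"
    using norm_SU2_le by (auto simp: bounded_iff)
  moreover have "closed SU2"
    unfolding SU2_def det_2
    by (intro closed_Collect_conj closed_Collect_eq continuous_intros)
  ultimately show ?thesis by (simp add: compact_eq_bounded_closed)
qed

lemma bounded_on_SU2:
  assumes "continuous_on SU2 (f :: cmat2 \<Rightarrow> 'a::real_normed_vector)"
  obtains B where "\<And>h. h \<in> SU2 \<Longrightarrow> norm (f h) \<le> B"
  using compact_imp_bounded[OF compact_continuous_image[OF assms compact_SU2]]
  unfolding bounded_iff by (metis imageI)

context
  fixes \<mu> :: "cmat2 measure"
  assumes haar: "normalized_Haar_SU2 \<mu>"
begin

lemma sets_haar: "sets \<mu> = sets (restrict_space borel SU2)"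
  using haar by (simp add: normalized_Haar_SU2_def)

lemma space_haar: "space \<mu> = SU2"
  using sets_eq_imp_space_eq[OF sets_haar] by (simp add: space_restrict_space)

lemma prob_space_haar: "prob_space \<mu>"
  using haar by (intro prob_spaceI) (simp add: space_haar normalized_Haar_SU2_def)

lemma borel_measurable_haar:
  fixes f :: "cmat2 \<Rightarrow> 'a::topological_space"
  shows "continuous_on SU2 f \<Longrightarrow> f \<in> borel_measurable \<mu>"
  unfolding measurable_cong_sets[OF sets_haar refl]
  by (rule borel_measurable_continuous_on_restrict)

lemma integrable_haar_bounded:
  fixes f :: "cmat2 \<Rightarrow> 'a::{banach, second_countable_topology}"
  assumes "f \<in> borel_measurable \<mu>" "\<And>h. h \<in> SU2 \<Longrightarrow> norm (f h) \<le> B"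
  shows "integrable \<mu> f"
proof -
  interpret prob_space \<mu> by (rule prob_space_haar)
  show ?thesis
    by (rule integrable_const_bound[where B = B]) (use assms in \<open>auto simp: space_haar\<close>)
qed

lemma integrable_haar:
  fixes f :: "cmat2 \<Rightarrow> 'a::{banach, second_countable_topology}"
  assumes "continuous_on SU2 f"
  shows "integrable \<mu> f"
  using bounded_on_SU2[OF assms] integrable_haar_bounded borel_measurable_haar[OF assms] by metis

lemma haar_invariant:
  fixes f :: "cmat2 \<Rightarrow> 'a::{banach, second_countable_topology}"
  assumes u: "u \<in> SU2" and f: "continuous_on SU2 f"
  shows "(\<integral>h. f (u ** h) \<partial>\<mu>) = (\<integral>h. f h \<partial>\<mu>)"
proof -
  have "(\<lambda>h. u ** h) \<in> measurable (restrict_space borel SU2) (restrict_space borel SU2)"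
    using SU2_mult[OF u]
    by (intro measurable_restrict_space3 borel_measurable_continuous_onI continuous_intros) auto
  then have "(\<lambda>h. u ** h) \<in> measurable \<mu> \<mu>"
    by (simp add: measurable_cong_sets[OF sets_haar sets_haar])
  then have "(\<integral>h. f h \<partial>distr \<mu> \<mu> (\<lambda>h. u ** h)) = (\<integral>h. f (u ** h) \<partial>\<mu>)"
    by (rule integral_distr) (rule borel_measurable_haar[OF f])
  then show ?thesis
    using haar u by (simp add: normalized_Haar_SU2_def)
qed

text \<open>Entry (j, l) of the average over the group of pi(h) E pi(h^-1), where E is the matrix
  unit at (i, k) from the representation of degree \<open>m\<close> to that of degree
  \<open>n\<close>. On SU(2) inversion is \<open>dagger\<close>, which is visibly
  continuous.\<close>

definition schur_int :: "nat \<Rightarrow> nat \<Rightarrow> nat \<Rightarrow> nat \<Rightarrow> nat \<Rightarrow> nat \<Rightarrow> complex" where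
  "schur_int n m i k j l = (\<integral>h. spin_rep n h j i * spin_rep m (dagger h) k l \<partial>\<mu>)"

text \<open>Left invariance permits the substitution of \<open>u ** h\<close> for \<open>h\<close>,
  which moves \<open>u\<close> from the right of the averaged operator to its left.\<close>

lemma schur_int_intertwines:
  assumes u: "u \<in> SU2" and le: "i \<le> n" "j \<le> n" "k \<le> m" "l \<le> m"
  shows "(\<Sum>b\<le>m. schur_int n m i k j b * spin_rep m u b l) = (\<Sum>a\<le>n. spin_rep n u j a * schur_int n m i k a l)"
proof -
  have int: "integrable \<mu> (\<lambda>h. spin_rep n h j i * spin_rep m (dagger h) k l)" for j l
    by (intro integrable_haar continuous_intros)
  have "(\<Sum>b\<le>m. schur_int n m i k j b * spin_rep m u b l) =
    (\<integral>h. (\<Sum>b\<le>m. spin_rep n h j i * spin_rep m (dagger h) k b * spin_rep m u b l) \<partial>\<mu>)"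
    unfolding schur_int_def using int by (subst Bochner_Integration.integral_sum) auto
  also have "\<dots> = (\<integral>h. spin_rep n h j i * spin_rep m (dagger h ** u) k l \<partial>\<mu>)"
    using le by (simp add: spin_rep_mult sum_distrib_left mult.assoc)
  also have "\<dots> = (\<integral>h. spin_rep n (u ** h) j i * spin_rep m (dagger (u ** h) ** u) k l \<partial>\<mu>)"
    by (rule haar_invariant[OF u, symmetric]) (intro continuous_intros)
  also have "\<dots> = (\<integral>h. spin_rep n (u ** h) j i * spin_rep m (dagger h) k l \<partial>\<mu>)"
    by (simp add: dagger_mult SU2_left_inverse[OF u] flip: matrix_mul_assoc)
  also have "\<dots> = (\<integral>h. (\<Sum>a\<le>n. spin_rep n u j a * (spin_rep n h a i * spin_rep m (dagger h) k l)) \<partial>\<mu>)"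
    using le by (simp add: spin_rep_mult sum_distrib_right mult.assoc)
  also have "\<dots> = (\<Sum>a\<le>n. spin_rep n u j a * schur_int n m i k a l)"
    unfolding schur_int_def using int by (subst Bochner_Integration.integral_sum) auto
  finally show ?thesis .
qed

lemma spin_rep_diagonal:
  assumes "l \<le> n" "k \<le> n"
  shows "spin_rep n (mat2 a 0 0 d) l k = (if l = k then a ^ (n - k) * d ^ k else 0)"
proof -
  have "[:0, d:] ^ k = monom (d ^ k) k"
    by (simp add: monom_altdef[of d] flip: monom_power[of d 1, simplified])
  then show ?thesis
    by (simp add: spin_rep_def poly_const_pow)
qed

text \<open>A diagonal \<open>u\<close> acts by phases determined by the weights n - 2 j and m - 2
  l; intertwining multiplies the entry by either phase with the same result.\<close>

lemma schur_int_weight: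
  assumes le: "i \<le> n" "j \<le> n" "k \<le> m" "l \<le> m" and nz: "schur_int n m i k j l \<noteq> 0"
  shows "int m - 2 * int l = int n - 2 * int j"
proof (rule ccontr)
  assume ne: "int m - 2 * int l \<noteq> int n - 2 * int j"
  define D where "D = (int m - 2 * int l) - (int n - 2 * int j)"
  \<comment> \<open>With this angle the two phases differ by the factor -1.\<close>
  define \<theta> where "\<theta> = pi / of_int D"
  have D: "D \<noteq> 0" using ne by (simp add: D_def)
  define u where "u = mat2 (cis \<theta>) 0 0 (cis (- \<theta>))"
  have u: "u \<in> SU2"
    by (auto simp: SU2_def mat2_eq_iff mult_component2 u_def det_2 cis_cnj cis_mult)
  have w: "cis \<theta> ^ (N - k) * cis (- \<theta>) ^ k = cis ((real N - 2 * real k) * \<theta>)" if "k \<le> N" for N k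
  proof -
    have "real (N - k) * \<theta> + real k * - \<theta> = (real N - 2 * real k) * \<theta>"
      using that by (simp add: of_nat_diff algebra_simps)
    then show ?thesis by (simp only: Complex.DeMoivre cis_mult)
  qed
  have "(\<Sum>b\<le>m. schur_int n m i k j b * spin_rep m u b l) = schur_int n m i k j l * cis ((real m - 2 * real l) * \<theta>)"
    using le by (simp add: u_def spin_rep_diagonal w sum.delta if_distrib cong: if_cong)
  moreover have "(\<Sum>a\<le>n. spin_rep n u j a * schur_int n m i k a l) = cis ((real n - 2 * real j) * \<theta>) * schur_int n m i k j l"
    using le by (simp add: u_def spin_rep_diagonal w sum.delta' if_distrib if_distribR cong: if_cong)
  ultimately have "cis ((real m - 2 * real l) * \<theta>) = cis ((real n - 2 * real j) * \<theta>)"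
    using schur_int_intertwines[OF u le] nz by simp
  then have "cis ((real m - 2 * real l) * \<theta> - (real n - 2 * real j) * \<theta>) = 1"
    by (simp flip: cis_divide)
  also have "(real m - 2 * real l) * \<theta> - (real n - 2 * real j) * \<theta> = of_int D * \<theta>"
    by (simp add: D_def algebra_simps)
  also have "\<dots> = pi" using D by (simp add: \<theta>_def)
  finally show False by simp
qed

text \<open>Up to binomial coefficients, the entries in row 0 and column 0 are monomials in the
  entries of \<open>u\<close>, so a unitary matrix without zero entries suffices; the triple 3, 4, 5
  gives a rational one.\<close>

lemma generic_SU2:
  "\<exists>u\<in>SU2. (\<forall>n. \<forall>k\<le>n. spin_rep n u 0 k \<noteq> 0 \<and> spin_rep n u k 0 \<noteq> 0)"
proof
  let ?u = "mat2 (3/5) (4/5) (- 4/5) (3/5)"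
  show "?u \<in> SU2"
    by (auto simp: SU2_def mat2_eq_iff mult_component2 det_2)
  show "\<forall>n. \<forall>k\<le>n. spin_rep n ?u 0 k \<noteq> 0 \<and> spin_rep n ?u k 0 \<noteq> 0"
    by (simp add: spin_rep_def coeff_mult coeff_linear_poly_power)
qed

text \<open>
  Intertwining with diagonal matrices leaves only the matrix entries of equal weight. One further group
  element whose first row and column have no zero entry then makes the intertwiner scalar, or zero
  if the spins differ.
\<close>

lemma schur_orthogonality:
  assumes le: "i \<le> n" "j \<le> n" "k \<le> m" "l \<le> m"
  shows "schur_int n m i k j l = (if n = m \<and> j = l \<and> i = k then 1 / of_nat (n + 1) else 0)"
proof -
  obtain u where u: "u \<in> SU2" "\<forall>n. \<forall>k\<le>n. spin_rep n u 0 k \<noteq> 0 \<and> spin_rep n u k 0 \<noteq> 0"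
    using generic_SU2 by blast
  let ?T = "schur_int n m i k"
  have weight: "int m - 2 * int b = int n - 2 * int a" if "?T a b \<noteq> 0" "a \<le> n" "b \<le> m" for a b
    using schur_int_weight[of i n a k m b] le that by simp
  consider "n = m" | "n < m" | "m < n" by linarith
  then show ?thesis
  proof cases
    case 1
    have off: "?T a b = 0" if "a \<noteq> b" "a \<le> n" "b \<le> n" for a b
      using weight[of a b] that 1 by auto
    have diag: "?T b b = ?T 0 0" if b: "b \<le> n" for b
    proof -
      \<comment> \<open>Entry (0, b) of the intertwining relation; each sum has one surviving
        term.\<close>
      have "?T 0 0 * spin_rep n u 0 b = (\<Sum>c\<le>m. ?T 0 c * spin_rep m u c b)"
        using 1 off by (subst sum.mono_neutral_right[of _ "{0}"]) auto
      also have "\<dots> = (\<Sum>a\<le>n. spin_rep n u 0 a * ?T a b)"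
        using le b 1 by (intro schur_int_intertwines[OF u(1)]) auto
      also have "\<dots> = spin_rep n u 0 b * ?T b b"
        using 1 off b by (subst sum.mono_neutral_right[of _ "{b}"]) auto
      finally have "?T 0 0 * spin_rep n u 0 b = ?T b b * spin_rep n u 0 b"
        by (simp only: mult.commute)
      moreover have "spin_rep n u 0 b \<noteq> 0" using u(2) b by blast
      ultimately show ?thesis by (metis mult_right_cancel)
    qed
    \<comment> \<open>The common diagonal value is found from the trace, which collapses under the
      integral because \<open>dagger h ** h\<close> is the identity.\<close>
    have "of_nat (n + 1) * ?T 0 0 = (\<Sum>a\<le>n. ?T 0 0)"
      by simp
    also have "\<dots> = (\<Sum>a\<le>n. ?T a a)"
      by (intro sum.cong refl diag[symmetric]) simp
    also have "\<dots> = (\<integral>h. (\<Sum>a\<le>n. spin_rep n h a i * spin_rep m (dagger h) k a) \<partial>\<mu>)"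
      unfolding schur_int_def
      by (subst Bochner_Integration.integral_sum) (auto intro!: integrable_haar continuous_intros)
    also have "\<dots> = (\<integral>h. spin_rep n (dagger h ** h) k i \<partial>\<mu>)"
      using le 1 by (simp add: spin_rep_mult mult.commute)
    also have "\<dots> = (\<integral>h. (if k = i then 1 else 0) \<partial>\<mu>)"
      by (intro Bochner_Integration.integral_cong) (auto simp: space_haar SU2_left_inverse spin_rep_mat1)
    also have "\<dots> = (if k = i then 1 else 0)"
      using prob_space.prob_space[OF prob_space_haar] by simp
    finally have T0: "of_nat (n + 1) * ?T 0 0 = (if k = i then 1 else 0)" .
    have "(of_nat (n + 1) :: complex) \<noteq> 0"
      by (simp only: of_nat_eq_0_iff)
    then have "?T 0 0 = of_nat (n + 1) * ?T 0 0 / of_nat (n + 1)"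
      by (rule nonzero_mult_div_cancel_left[symmetric])
    then have T0: "?T 0 0 = (if k = i then 1 / of_nat (n + 1) else 0)"
      unfolding T0 by simp
    show ?thesis
    proof (cases "j = l")
      case True
      have "?T j l = ?T 0 0" using diag[OF le(2)] True by simp
      then show ?thesis unfolding T0 using True 1 by auto
    next
      case False
      have "?T j l = 0" using le 1 False by (intro off) simp_all
      then show ?thesis using False by simp
    qed
  next
    case 2
    have "?T j l = 0"
    proof (rule ccontr)
      assume nz: "?T j l \<noteq> 0"
      then have w: "int m - 2 * int l = int n - 2 * int j" using weight le by blast
      \<comment> \<open>Row \<open>j\<close> lives in column \<open>l\<close> only, whereas column 0
        vanishes: its weight m exceeds every weight n - 2 a.\<close>
      have "?T j l * spin_rep m u l 0 = (\<Sum>b\<le>m. ?T j b * spin_rep m u b 0)"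
        using w weight[of j] le by (subst sum.mono_neutral_right[of _ "{l}"]) fastforce+
      also have "\<dots> = (\<Sum>a\<le>n. spin_rep n u j a * ?T a 0)"
        using le by (intro schur_int_intertwines[OF u(1)]) auto
      also have "\<dots> = 0"
        using 2 weight[of _ 0] by (intro sum.neutral) fastforce
      finally have "?T j l * spin_rep m u l 0 = 0" .
      moreover have "spin_rep m u l 0 \<noteq> 0" using u(2) le(4) by blast
      ultimately show False using nz by (simp only: mult_eq_0_iff simp_thms)
    qed
    with 2 show ?thesis by simp
  next
    case 3
    have "?T j l = 0"
    proof (rule ccontr)
      assume nz: "?T j l \<noteq> 0"
      then have w: "int m - 2 * int l = int n - 2 * int j" using weight le by blast
      \<comment> \<open>The mirror image: now row 0 vanishes, its weight n exceeding every m - 2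
        b.\<close>
      have "spin_rep n u 0 j * ?T j l = (\<Sum>a\<le>n. spin_rep n u 0 a * ?T a l)"
        using w weight[of _ l] le by (subst sum.mono_neutral_right[of _ "{j}"]) fastforce+
      also have "\<dots> = (\<Sum>b\<le>m. ?T 0 b * spin_rep m u b l)"
        using le by (intro schur_int_intertwines[OF u(1), symmetric]) auto
      also have "\<dots> = 0"
        using 3 weight[of 0] by (intro sum.neutral) fastforce
      finally have "spin_rep n u 0 j * ?T j l = 0" .
      moreover have "spin_rep n u 0 j \<noteq> 0" using u(2) le(2) by blast
      ultimately show False using nz by (simp only: mult_eq_0_iff simp_thms)
    qed
    with 3 show ?thesis by simp
  qed
qed

lemma spin_char_mult:
  "spin_char n (A ** B) = (\<Sum>p\<in>{..n}\<times>{..n}. spin_rep n A (fst p) (snd p) * spin_rep n B (snd p) (fst p))"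
proof -
  have "spin_char n (A ** B) = (\<Sum>i\<le>n. \<Sum>j\<le>n. spin_rep n A i j * spin_rep n B j i)"
    unfolding spin_char_def by (rule sum.cong) (simp_all add: spin_rep_mult)
  then show ?thesis
    by (simp add: sum.cartesian_product case_prod_beta)
qed

text \<open>Expanded in matrix entries, each index pair meets only its transpose. \<open>A\<close>
  and \<open>B\<close> contribute constants to the integral, so complex arguments are covered
  without analytic continuation.\<close>

lemma spin_char_convolution:
  "(\<integral>h. spin_char n (A ** dagger h) * spin_char m (B ** h) \<partial>\<mu>) =
    (if n = m then spin_char n (A ** B) / of_nat (n + 1) else 0)"
proof -
  let ?X = "\<lambda>n::nat. {..n} \<times> {..n}"
  have int: "integrable \<mu> (\<lambda>h. c * (spin_rep m h j i * spin_rep n (dagger h) k l))" for i j k l c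
    by (intro integrable_haar continuous_intros)
  have "(\<integral>h. spin_char n (A ** dagger h) * spin_char m (B ** h) \<partial>\<mu>) =
    (\<integral>h. (\<Sum>p\<in>?X n. \<Sum>q\<in>?X m. (spin_rep n A (fst p) (snd p) * spin_rep m B (fst q) (snd q)) *
      (spin_rep m h (snd q) (fst q) * spin_rep n (dagger h) (snd p) (fst p))) \<partial>\<mu>)"
    unfolding spin_char_mult sum_product
    by (intro Bochner_Integration.integral_cong sum.cong refl) (simp only: mult_ac)
  also have "\<dots> = (\<Sum>p\<in>?X n. \<integral>h. (\<Sum>q\<in>?X m. (spin_rep n A (fst p) (snd p) * spin_rep m B (fst q) (snd q)) *
      (spin_rep m h (snd q) (fst q) * spin_rep n (dagger h) (snd p) (fst p))) \<partial>\<mu>)"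
    by (intro Bochner_Integration.integral_sum Bochner_Integration.integrable_sum int)
  also have "\<dots> = (\<Sum>p\<in>?X n. \<Sum>q\<in>?X m. \<integral>h. (spin_rep n A (fst p) (snd p) * spin_rep m B (fst q) (snd q)) *
      (spin_rep m h (snd q) (fst q) * spin_rep n (dagger h) (snd p) (fst p)) \<partial>\<mu>)"
    by (intro sum.cong refl Bochner_Integration.integral_sum int)
  also have "\<dots> = (\<Sum>p\<in>?X n. \<Sum>q\<in>?X m. (spin_rep n A (fst p) (snd p) * spin_rep m B (fst q) (snd q)) *
      schur_int m n (fst q) (snd p) (snd q) (fst p))"
    by (simp only: schur_int_def integral_mult_right_zero)
  also have "\<dots> = (\<Sum>p\<in>?X n. if n = m then
      spin_rep n A (fst p) (snd p) * spin_rep n B (snd p) (fst p) / of_nat (n + 1) else 0)"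
  proof (rule sum.cong[OF refl])
    fix p assume p: "p \<in> ?X n"
    have "(\<Sum>q\<in>?X m. (spin_rep n A (fst p) (snd p) * spin_rep m B (fst q) (snd q)) *
        schur_int m n (fst q) (snd p) (snd q) (fst p)) =
      (\<Sum>q\<in>?X m. if q = prod.swap p then if n = m then
        spin_rep n A (fst p) (snd p) * spin_rep n B (snd p) (fst p) / of_nat (n + 1) else 0 else 0)"
    proof (rule sum.cong[OF refl])
      fix q assume q: "q \<in> ?X m"
      have "schur_int m n (fst q) (snd p) (snd q) (fst p) =
        (if m = n \<and> snd q = fst p \<and> fst q = snd p then 1 / of_nat (m + 1) else 0)"
        using p q by (intro schur_orthogonality) auto
      then show "(spin_rep n A (fst p) (snd p) * spin_rep m B (fst q) (snd q)) *
          schur_int m n (fst q) (snd p) (snd q) (fst p) =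
        (if q = prod.swap p then if n = m then
          spin_rep n A (fst p) (snd p) * spin_rep n B (snd p) (fst p) / of_nat (n + 1) else 0 else 0)"
        by (cases p; cases q) auto
    qed
    also have "\<dots> = (if n = m then spin_rep n A (fst p) (snd p) * spin_rep n B (snd p) (fst p) / of_nat (n + 1) else 0)"
      using p by (subst sum.delta) auto
    finally show "(\<Sum>q\<in>?X m. (spin_rep n A (fst p) (snd p) * spin_rep m B (fst q) (snd q)) *
        schur_int m n (fst q) (snd p) (snd q) (fst p)) =
      (if n = m then spin_rep n A (fst p) (snd p) * spin_rep n B (snd p) (fst p) / of_nat (n + 1) else 0)" .
  qed
  also have "\<dots> = (if n = m then spin_char n (A ** B) / of_nat (n + 1) else 0)"
    by (simp add: spin_char_mult sum_divide_distrib)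
  finally show ?thesis .
qed

end

section \<open>Poisson summation for the Gaussian\<close>

lemma cos_times_one_plus_cos:
  "(1 + cos x) * cos (of_int k * x) =
    cos (of_int k * x) + (cos (of_int (k + 1) * x) + cos (of_int (k - 1) * x)) / (2::real)"
  by (simp add: algebra_simps cos_add cos_diff)

text \<open>The kernels \<open>(1 + cos (2 \<pi> y)) ^ n\<close> are trigonometric polynomials that concentrate at 0.\<close>

lemma eq_0_if_cos_coeffs_eq_0:
  fixes D :: "real \<Rightarrow> real"
  assumes cont: "continuous_on {-1/2..1/2} D"
    and coeffs: "\<And>k::nat. integral {-1/2..1/2} (\<lambda>y. D y * cos (of_nat k * (2 * pi * y))) = 0"
  shows "D 0 = 0"
proof (rule ccontr)
  assume nz: "D 0 \<noteq> 0"
  define F where "F y = sgn (D 0) * D y" for y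
  define w where "w y = 1 + cos (2 * pi * y)" for y :: real
  let ?I = "{-1/2..1/2::real}"
  have F0: "F 0 > 0" using nz by (simp add: F_def sgn_if)
  have contF: "continuous_on ?I F"
    unfolding F_def by (intro continuous_intros cont)
  have contw: "continuous_on S w" for S
    unfolding w_def by (intro continuous_intros)
  have w_bounds: "0 \<le> w y" for y
    using cos_ge_minus_one[of "2 * pi * y"] unfolding w_def by linarith
  have int: "(\<lambda>y. F y * w y ^ n * cos (of_int k * (2 * pi * y))) integrable_on ?I" for n k
    by (intro integrable_continuous_interval continuous_on_mult contF continuous_on_power[OF contw])
       (intro continuous_intros)
  \<comment> \<open>A factor \<open>w\<close> shifts frequencies by one in both directions, so the
    induction runs over all integer frequencies at once.\<close>
  have zero: "integral ?I (\<lambda>y. F y * w y ^ n * cos (of_int k * (2 * pi * y))) = 0" for n k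
  proof (induction n arbitrary: k)
    case 0
    have "cos (of_int k * (2 * pi * y)) = cos (of_nat (nat \<bar>k\<bar>) * (2 * pi * y))" for y
    proof (cases "k \<ge> 0")
      case False
      then have "of_int k * (2 * pi * y) = - (of_nat (nat \<bar>k\<bar>) * (2 * pi * y))"
        by simp
      then show ?thesis by (simp only: cos_minus)
    qed simp
    then show ?case
      using coeffs[of "nat \<bar>k\<bar>"] by (simp add: F_def mult.assoc)
  next
    case (Suc n)
    have "F y * w y ^ Suc n * cos (of_int k * (2 * pi * y)) =
      F y * w y ^ n * cos (of_int k * (2 * pi * y)) +
      (1/2) * (F y * w y ^ n * cos (of_int (k + 1) * (2 * pi * y))) +
      (1/2) * (F y * w y ^ n * cos (of_int (k - 1) * (2 * pi * y)))" for y
    proof -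
      have "F y * w y ^ Suc n * cos (of_int k * (2 * pi * y)) =
        F y * w y ^ n * ((1 + cos (2 * pi * y)) * cos (of_int k * (2 * pi * y)))"
        by (simp add: w_def)
      then show ?thesis
        unfolding cos_times_one_plus_cos by (simp add: algebra_simps)
    qed
    then show ?case
      using Suc[of k] Suc[of "k + 1"] Suc[of "k - 1"] int[of n k] int[of n "k + 1"] int[of n "k - 1"]
      by (simp add: integral_add integrable_add)
  qed
  obtain e where e: "e > 0" "\<And>y. y \<in> ?I \<Longrightarrow> \<bar>y\<bar> < e \<Longrightarrow> \<bar>F y - F 0\<bar> < F 0 / 2"
    using contF F0 unfolding continuous_on_iff
    by (elim ballE[of _ _ 0]) (auto simp: dist_real_def dest!: spec[of _ "F 0 / 2"])
  define d where "d = min (e / 2) (1 / 4)"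
  have d: "0 < d" "d < 1/2" "d < e"
    using e by (auto simp: d_def)
  have near: "F y \<ge> F 0 / 2" if "\<bar>y\<bar> \<le> d" for y
    using e(2)[of y] that d by (simp add: abs_if split: if_splits)
  obtain B where B: "\<And>y. y \<in> ?I \<Longrightarrow> \<bar>F y\<bar> \<le> B"
    using compact_imp_bounded[OF compact_continuous_image[OF contF compact_Icc]]
    unfolding bounded_iff by (metis imageI real_norm_def)
  have B0: "B \<ge> 0" using B[of 0] by auto
  have w_mono: "w y \<le> w x" if "\<bar>x\<bar> \<le> \<bar>y\<bar>" "\<bar>y\<bar> \<le> 1/2" for x y
  proof -
    have "w z = 1 + cos (2 * pi * \<bar>z\<bar>)" for z
      by (simp add: w_def abs_if)
    moreover have "cos (2 * pi * \<bar>y\<bar>) \<le> cos (2 * pi * \<bar>x\<bar>)"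
      by (rule cos_monotone_0_pi_le) (use that in auto)
    ultimately show ?thesis by simp
  qed
  have wlt: "w d < w (d / 2)"
    unfolding w_def using d by (auto intro!: cos_monotone_0_pi)
  \<comment> \<open>Three regions: a positive lower bound near 0, mere nonnegativity up to
    \<open>d\<close>, and beyond \<open>d\<close> an error controlled by the smaller value
    \<open>w d\<close>.\<close>
  have lower: "(if y \<in> {-(d/2)..d/2} then F 0 / 2 * w (d/2) ^ n else 0) - B * w d ^ n \<le> F y * w y ^ n"
    if y: "y \<in> ?I" for y n
  proof (cases "\<bar>y\<bar> \<le> d")
    case True
    have "F 0 / 2 * w (d/2) ^ n \<le> F y * w y ^ n" if "\<bar>y\<bar> \<le> d / 2"
      using near[OF True] F0 w_mono[of y "d/2"] that d w_bounds
      by (intro mult_mono power_mono) auto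
    moreover have "0 \<le> F y * w y ^ n" "0 \<le> B * w d ^ n"
      using near[OF True] F0 w_bounds B0 by simp_all
    moreover have "y \<in> {-(d/2)..d/2} \<longleftrightarrow> \<bar>y\<bar> \<le> d / 2"
      by auto
    ultimately show ?thesis
      by (smt (verit))
  next
    case False
    have "\<bar>F y * w y ^ n\<bar> \<le> B * w d ^ n"
      unfolding abs_mult using B[OF y] B0 w_bounds[of y] w_bounds[of d] w_mono[of d y] False d y
      by (intro mult_mono) (auto intro: power_mono)
    then show ?thesis
      using False d by auto
  qed
  have "F 0 / 2 * w (d/2) ^ n * d \<le> B * w d ^ n" for n
  proof -
    let ?g = "\<lambda>y. if y \<in> {-(d/2)..d/2} then F 0 / 2 * w (d/2) ^ n else 0"
    have sub: "{-(d/2)..d/2} \<inter> ?I = {-(d/2)..d/2}" using d by auto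
    have gi: "?g integrable_on ?I"
      unfolding integrable_restrict_Int sub by (rule integrable_const_ivl)
    have "integral ?I (\<lambda>y. ?g y - B * w d ^ n) \<le> integral ?I (\<lambda>y. F y * w y ^ n)"
      using int[of n 0] by (intro integral_le lower integrable_diff gi) auto
    also have "\<dots> = 0" using zero[of n 0] by simp
    also have "integral ?I (\<lambda>y. ?g y - B * w d ^ n) = integral ?I ?g - B * w d ^ n"
      by (subst integral_diff[OF gi]) auto
    also have "integral ?I ?g = F 0 / 2 * w (d/2) ^ n * d"
      unfolding integral_restrict_Int sub using d by simp
    finally show ?thesis by simp
  qed
  \<comment> \<open>The peak contributes at least a multiple of w (d/2)^n, the error at most a
    multiple of w d^n; the quotient of the two tends to 0.\<close>
  then have ineq: "F 0 / 2 * d \<le> B * (w d / w (d/2)) ^ n" for n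
    using wlt w_bounds[of d] by (simp add: power_divide field_simps)
  have "(\<lambda>n. B * (w d / w (d/2)) ^ n) \<longlonglongrightarrow> B * 0"
    using wlt w_bounds[of d] by (intro tendsto_intros LIMSEQ_realpow_zero) (auto simp: field_simps)
  then have "F 0 / 2 * d \<le> B * 0"
    using ineq by (intro LIMSEQ_le_const) auto
  with F0 d show False by (simp add: mult_le_0_iff)
qed

text \<open>A rescaling of the characteristic function of the standard normal distribution; the
  phase \<alpha> is obtained by rotating the complex integral before taking real parts.\<close>

lemma gaussian_fourier:
  fixes s \<xi> :: real
  assumes "s > 0"
  shows "integrable lborel (\<lambda>z. exp (- s * z\<^sup>2))"
    and "(LBINT z. exp (- s * z\<^sup>2) * cos (\<xi> * z - \<alpha>)) = sqrt (pi / s) * exp (- \<xi>\<^sup>2 / (4 * s)) * cos \<alpha>"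
proof -
  define c where "c = sqrt (2 * s)"
  have c: "c > 0" "c\<^sup>2 = 2 * s" using assms by (auto simp: c_def)
  have dens: "std_normal_density (c * z) = exp (- s * z\<^sup>2) / sqrt (2 * pi)" for z
    using c by (simp add: std_normal_density_def power_mult_distrib)
  have "integrable lborel (\<lambda>z. std_normal_density (0 + c * z))"
    using c by (subst lborel_integrable_real_affine_iff) auto
  then have "integrable lborel (\<lambda>z. sqrt (2 * pi) * std_normal_density (c * z))"
    by (intro integrable_mult_right) simp
  then show *: "integrable lborel (\<lambda>z. exp (- s * z\<^sup>2))"
    by (simp add: dens)
  define z0 where "z0 = (CLBINT z. exp (- s * z\<^sup>2) * cis (\<xi> * z))"
  have [measurable]: "(\<lambda>z. cis (\<xi> * z)) \<in> borel_measurable borel"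
    by (intro borel_measurable_continuous_onI continuous_intros)
  have int: "integrable lborel (\<lambda>z. exp (- s * z\<^sup>2) * cis (\<xi> * z))"
    by (rule Bochner_Integration.integrable_bound[OF *]) (auto simp: norm_mult)
  have eq: "std_normal_density (0 + c * z) *\<^sub>R cis (\<xi> / c * (0 + c * z)) =
      (1 / sqrt (2 * pi)) *\<^sub>R (exp (- s * z\<^sup>2) * cis (\<xi> * z))" for z
    using c dens[of z] by (simp add: scaleR_conv_of_real)
  have "complex_of_real (exp (- ((\<xi>/c)\<^sup>2) / 2)) = char std_normal_distribution (\<xi>/c)"
    by (simp add: char_std_normal_distribution)
  also have "\<dots> = (CLBINT x. std_normal_density x *\<^sub>R cis (\<xi>/c * x))"
    unfolding char_def cis_conv_exp by (subst integral_density) auto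
  also have "\<dots> = \<bar>c\<bar> *\<^sub>R (CLBINT z. std_normal_density (0 + c * z) *\<^sub>R cis (\<xi>/c * (0 + c * z)))"
    using c by (intro lborel_integral_real_affine) auto
  also have "\<dots> = \<bar>c\<bar> *\<^sub>R (1 / sqrt (2 * pi)) *\<^sub>R z0"
    unfolding eq z0_def by (simp only: integral_scaleR_right)
  finally have char: "complex_of_real (exp (- ((\<xi>/c)\<^sup>2) / 2)) = \<bar>c\<bar> *\<^sub>R (1 / sqrt (2 * pi)) *\<^sub>R z0" .
  have e: "- ((\<xi>/c)\<^sup>2) / 2 = - \<xi>\<^sup>2 / (4 * s)"
    by (simp add: power_divide c(2))
  have "z0 = (sqrt (2 * pi) / c) *\<^sub>R (\<bar>c\<bar> *\<^sub>R (1 / sqrt (2 * pi)) *\<^sub>R z0)"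
    using c by simp
  also have "\<dots> = of_real (sqrt (2 * pi) / c * exp (- \<xi>\<^sup>2 / (4 * s)))"
    unfolding char[symmetric] e by (simp add: scaleR_conv_of_real)
  finally have z0: "z0 = of_real (sqrt (2 * pi) / c * exp (- \<xi>\<^sup>2 / (4 * s)))" .
  have "(LBINT z. exp (- s * z\<^sup>2) * cos (\<xi> * z - \<alpha>)) =
    (LBINT z. Re (cis (- \<alpha>) * (exp (- s * z\<^sup>2) * cis (\<xi> * z))))"
    by (intro Bochner_Integration.integral_cong) (simp_all add: cos_diff algebra_simps)
  also have "\<dots> = Re (cis (- \<alpha>) * z0)"
    unfolding z0_def using int by (subst integral_Re) (auto intro!: integrable_mult_right)
  also have "\<dots> = sqrt (2 * pi) / c * exp (- \<xi>\<^sup>2 / (4 * s)) * cos \<alpha>"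
    unfolding z0 by simp
  also have "sqrt (2 * pi) / c = sqrt (pi / s)"
    unfolding c_def by (simp flip: real_sqrt_divide)
  finally show "(LBINT z. exp (- s * z\<^sup>2) * cos (\<xi> * z - \<alpha>)) = sqrt (pi / s) * exp (- \<xi>\<^sup>2 / (4 * s)) * cos \<alpha>" .
qed

text \<open>Dominated convergence. The centre is a parameter because the unfolding in
  \<open>theta_transformation_aux\<close> exhausts the line by intervals around 1/2.\<close>

lemma integral_symmetric_interval_tendsto:
  fixes f :: "real \<Rightarrow> real"
  assumes f: "integrable lborel f"
  shows "(\<lambda>N. integral {c - real N..c + real N} f) \<longlonglongrightarrow> (LBINT z. f z)"
proof -
  have fm: "f \<in> borel_measurable lborel" using f by auto
  have set: "set_integrable lborel {a..b} f" for a b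
    unfolding set_integrable_def using f by (intro integrable_mult_indicator) auto
  have "(\<lambda>N. LBINT z. indicator {c - real N..c + real N} z *\<^sub>R f z) \<longlonglongrightarrow> (LBINT z. f z)"
  proof (rule integral_dominated_convergence[where w = "\<lambda>z. \<bar>f z\<bar>"])
    show "AE z in lborel. (\<lambda>N. indicator {c - real N..c + real N} z *\<^sub>R f z) \<longlonglongrightarrow> f z"
    proof (rule AE_I2, rule tendsto_eventually)
      fix z
      have "eventually (\<lambda>N. \<bar>z - c\<bar> \<le> real N) sequentially"
        using eventually_ge_at_top[of "nat \<lceil>\<bar>z - c\<bar>\<rceil>"] by eventually_elim linarith
      then show "eventually (\<lambda>N. indicator {c - real N..c + real N} z *\<^sub>R f z = f z) sequentially"
        by eventually_elim (auto simp: indicator_def)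
    qed
  qed (use f fm in \<open>auto simp: indicator_def\<close>)
  then show ?thesis
    using set_borel_integral_eq_integral(2)[OF set] by (simp add: set_lebesgue_integral_def)
qed

lemma summable_gauss:
  fixes s c :: real
  assumes "s > 0"
  shows "summable (\<lambda>m. real m ^ j * exp (c * real m - s * (real m)\<^sup>2))"
proof (rule summable_comparison_test)
  \<comment> \<open>The power costs \<open>j\<close>, the linear growth costs \<open>c\<close>, and
    the extra 1 leaves the geometric factor exp (- m) once the square is completed.\<close>
  define b where "b = c + real j + 1"
  have "norm (real m ^ j * exp (c * real m - s * (real m)\<^sup>2)) \<le> exp (b\<^sup>2 / (4 * s)) * exp (-1) ^ m" for m
  proof -
    have "real m ^ j \<le> exp (real m) ^ j"
      by (intro power_mono) (use exp_ge_add_one_self[of "real m"] in linarith, simp)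
    then have "real m ^ j * exp (c * real m - s * (real m)\<^sup>2) \<le> exp (real m) ^ j * exp (c * real m - s * (real m)\<^sup>2)"
      by (intro mult_right_mono) auto
    also have "\<dots> = exp (b * real m - s * (real m)\<^sup>2 - real m)"
      by (simp add: b_def algebra_simps flip: exp_of_nat_mult exp_add)
    also have "\<dots> \<le> exp (b\<^sup>2 / (4 * s) - real m)"
    proof -
      have "0 \<le> (2 * s * real m - b)\<^sup>2" by simp
      then have "b * real m - s * (real m)\<^sup>2 \<le> b\<^sup>2 / (4 * s)"
        using assms by (simp add: field_simps power2_eq_square)
      then show ?thesis by simp
    qed
    also have "\<dots> = exp (b\<^sup>2 / (4 * s)) * exp (-1) ^ m"
      by (simp flip: exp_of_nat_mult exp_add)
    finally show ?thesis by simp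
  qed
  then show "\<exists>N. \<forall>n\<ge>N. norm (real n ^ j * exp (c * real n - s * (real n)\<^sup>2)) \<le> exp (b\<^sup>2 / (4 * s)) * exp (-1) ^ n"
    by blast
  show "summable (\<lambda>n. exp (b\<^sup>2 / (4 * s)) * exp (-1::real) ^ n)"
    by (intro summable_mult summable_geometric) auto
qed

lemma suminf_integral_interval:
  fixes f :: "nat \<Rightarrow> real \<Rightarrow> real"
  assumes "\<And>n. continuous_on {a..b} (f n)"
    and "\<And>n x. x \<in> {a..b} \<Longrightarrow> \<bar>f n x\<bar> \<le> B n" and "summable B"
  shows "continuous_on {a..b} (\<lambda>x. \<Sum>n. f n x)"
    and "(\<lambda>N. \<Sum>n<N. integral {a..b} (f n)) \<longlonglongrightarrow> integral {a..b} (\<lambda>x. \<Sum>n. f n x)"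
proof -
  have u: "uniform_limit {a..b} (\<lambda>N x. \<Sum>n<N. f n x) (\<lambda>x. \<Sum>n. f n x) sequentially"
    by (rule Weierstrass_m_test[OF _ assms(3)]) (use assms(2) in auto)
  show "continuous_on {a..b} (\<lambda>x. \<Sum>n. f n x)"
    by (rule uniform_limit_theorem[OF _ u]) (auto intro!: always_eventually continuous_intros assms)
  obtain I J where IJ: "\<And>N. ((\<lambda>x. \<Sum>n<N. f n x) has_integral I N) {a..b}"
    "((\<lambda>x. \<Sum>n. f n x) has_integral J) {a..b}" "I \<longlonglongrightarrow> J"
    using uniform_limit_integral[OF u] assms(1) by (auto intro!: continuous_intros)
  have "I N = (\<Sum>n<N. integral {a..b} (f n))" for N
    using integral_unique[OF IJ(1)[of N]] assms(1)
    by (subst (asm) integral_sum) (auto intro: integrable_continuous_interval)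
  then have "I = (\<lambda>N. \<Sum>n<N. integral {a..b} (f n))"
    by (rule ext)
  then show "(\<lambda>N. \<Sum>n<N. integral {a..b} (f n)) \<longlonglongrightarrow> integral {a..b} (\<lambda>x. \<Sum>n. f n x)"
    using IJ(3) integral_unique[OF IJ(2)] by simp
qed

lemma integral_cos_period:
  "integral {-1/2..1/2} (\<lambda>y. cos (\<alpha> + 2 * pi * of_int j * y)) = (if j = 0 then cos \<alpha> else 0)"
proof (cases "j = 0")
  case False
  have int: "((\<lambda>y. cos (\<alpha> + 2 * pi * of_int j * y)) has_integral
     sin (\<alpha> + 2 * pi * of_int j * (1/2)) / (2 * pi * of_int j) -
     sin (\<alpha> + 2 * pi * of_int j * (-1/2)) / (2 * pi * of_int j)) {-1/2..1/2}"
  proof (rule fundamental_theorem_of_calculus)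
    fix y :: real
    have "((\<lambda>y. sin (\<alpha> + 2 * pi * of_int j * y) / (2 * pi * of_int j)) has_real_derivative
        cos (\<alpha> + 2 * pi * of_int j * y) * (2 * pi * of_int j) / (2 * pi * of_int j)) (at y within {-1/2..1/2})"
      by (intro DERIV_cdivide) (auto intro!: derivative_eq_intros)
    then show "((\<lambda>y. sin (\<alpha> + 2 * pi * of_int j * y) / (2 * pi * of_int j)) has_vector_derivative
        cos (\<alpha> + 2 * pi * of_int j * y)) (at y within {-1/2..1/2})"
      unfolding has_real_derivative_iff_has_vector_derivative using False by simp
  qed simp
  have "sin (\<alpha> + 2 * pi * of_int j * (1/2)) = sin ((\<alpha> + 2 * pi * of_int j * (-1/2)) + 2 * pi * of_int j)"
    by (simp add: algebra_simps)
  also have "\<dots> = sin (\<alpha> + 2 * pi * of_int j * (-1/2))"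
    unfolding sin_add[of _ "2 * pi * of_int j"] by (simp only: sin_int_2pin cos_int_2pin)
  finally have eq: "sin (\<alpha> + 2 * pi * of_int j * (1/2)) = sin (\<alpha> + 2 * pi * of_int j * (-1/2))" .
  show ?thesis
    using integral_unique[OF int] False unfolding eq by (simp only: diff_self if_False)
qed simp

text \<open>Orthogonality of cosines over a period. The mean 1 at k = 0, against 1/2 elsewhere, is
  the origin of the form "twice the sum minus 1" below.\<close>

lemma cos_mult_cos_period:
  fixes k l :: nat
  shows "integral {-1/2..1/2} (\<lambda>y. cos (2 * pi * of_nat l * (x + y)) * cos (of_nat k * (2 * pi * y))) =
    (if l = k then if k = 0 then 1 else cos (2 * pi * of_nat k * x) / 2 else 0)"
proof -
  let ?c = "\<lambda>j y. cos (2 * pi * of_nat l * x + 2 * pi * of_int j * y)"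
  have int: "?c j integrable_on {-1/2..1/2}" for j
    by (intro integrable_continuous_interval continuous_intros)
  have "cos (2 * pi * of_nat l * (x + y)) * cos (of_nat k * (2 * pi * y)) =
     (1/2) * ?c (int l + int k) y + (1/2) * ?c (int l - int k) y" for y
  proof -
    have "2 * pi * of_nat l * (x + y) - of_nat k * (2 * pi * y) = 2 * pi * of_nat l * x + 2 * pi * of_int (int l - int k) * y"
      "2 * pi * of_nat l * (x + y) + of_nat k * (2 * pi * y) = 2 * pi * of_nat l * x + 2 * pi * of_int (int l + int k) * y"
      by (simp_all add: algebra_simps)
    then show ?thesis
      unfolding cos_times_cos by (simp add: add_divide_distrib)
  qed
  then have "integral {-1/2..1/2} (\<lambda>y. cos (2 * pi * of_nat l * (x + y)) * cos (of_nat k * (2 * pi * y))) =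
    (1/2) * integral {-1/2..1/2} (?c (int l + int k)) + (1/2) * integral {-1/2..1/2} (?c (int l - int k))"
    using int[of "int l + int k"] int[of "int l - int k"] by (simp add: integral_add)
  then show ?thesis
    unfolding integral_cos_period by (auto split: if_splits)
qed

text \<open>The left side sums the Gaussian over all integer translates, split into - m and m + 1.
  Both sides are regarded as functions of a shift y over one period, and their cosine coefficients
  agree. This detects only the value at y = 0, which is enough since \<open>x0\<close> is
  arbitrary.\<close>

lemma theta_transformation_aux:
  fixes s x0 :: real
  assumes s: "s > 0"
  shows "(\<Sum>m. exp (- s * (x0 - real m)\<^sup>2) + exp (- s * (x0 + 1 + real m)\<^sup>2)) =
    sqrt (pi / s) * (2 * (\<Sum>k. exp (- (pi\<^sup>2 / s) * (real k)\<^sup>2) * cos (2 * pi * real k * x0)) - 1)"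
proof -
  define \<phi> where "\<phi> z = exp (- s * z\<^sup>2)" for z
  define a where "a = sqrt (pi / s)"
  define E where "E k = exp (- (pi\<^sup>2 / s) * (real k)\<^sup>2)" for k
  let ?I = "{-1/2..1/2::real}"
  define g where "g m y = \<phi> (x0 + y - real m) + \<phi> (x0 + y + 1 + real m)" for m y
  \<comment> \<open>Dominates the shifts x0 + y and x0 + y + 1 for |y| \<le> 1/2, so that one
    majorant serves the whole period.\<close>
  define X where "X = \<bar>x0\<bar> + 2"
  define B where "B m = 2 * exp (2 * s * X * real m - s * (real m)\<^sup>2)" for m
  have \<phi>_le: "\<phi> (real m - v) \<le> exp (2 * s * X * real m - s * (real m)\<^sup>2)" if "\<bar>v\<bar> \<le> X" for m v
  proof -
    have "v * real m \<le> X * real m" using that by (intro mult_right_mono) auto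
    moreover have "(real m - v)\<^sup>2 - ((real m)\<^sup>2 - 2 * (X * real m)) = v\<^sup>2 + 2 * (X * real m - v * real m)"
      by (simp add: power2_eq_square algebra_simps)
    ultimately have "0 \<le> (real m - v)\<^sup>2 - ((real m)\<^sup>2 - 2 * (X * real m))"
      by (simp only:) (intro add_nonneg_nonneg zero_le_power2 mult_nonneg_nonneg, simp_all)
    then have "(real m)\<^sup>2 - 2 * (X * real m) \<le> (real m - v)\<^sup>2"
      by simp
    then have "s * ((real m)\<^sup>2 - 2 * (X * real m)) \<le> s * (real m - v)\<^sup>2"
      using s by (intro mult_left_mono) auto
    then show ?thesis unfolding \<phi>_def by (simp add: algebra_simps)
  qed
  have g_le: "\<bar>g m y\<bar> \<le> B m" if "y \<in> ?I" for m y
  proof -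
    have "\<phi> (x0 + y - real m) = \<phi> (real m - (x0 + y))"
      by (simp add: \<phi>_def power2_commute)
    moreover have "\<phi> (x0 + y + 1 + real m) = \<phi> (real m - (- (x0 + y + 1)))"
      by (simp add: algebra_simps)
    moreover have "\<bar>x0 + y\<bar> \<le> X" "\<bar>- (x0 + y + 1)\<bar> \<le> X"
      using that by (auto simp: X_def abs_if)
    ultimately have "g m y \<le> B m"
      using \<phi>_le[of "x0 + y" m] \<phi>_le[of "- (x0 + y + 1)" m] by (simp add: g_def B_def)
    moreover have "0 \<le> g m y"
      by (simp add: g_def \<phi>_def)
    ultimately show ?thesis by simp
  qed
  have B: "summable B"
    unfolding B_def using summable_gauss[OF s, of 0 "2 * s * X"] by (intro summable_mult) simp
  have cont_\<phi>: "continuous_on S (\<lambda>y. \<phi> (h y))" if "continuous_on S h" for S and h :: "real \<Rightarrow> real"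
    unfolding \<phi>_def by (intro continuous_intros that)
  have cont_g: "continuous_on S (g m)" for S m
    unfolding g_def by (intro continuous_intros cont_\<phi>)
  have sg: "summable (\<lambda>m. g m y)" if "y \<in> ?I" for y
    using g_le[OF that] by (intro summable_comparison_test[OF _ B]) auto
  define G where "G y = (\<Sum>m. g m y)" for y
  have contG: "continuous_on ?I G"
    unfolding G_def by (rule suminf_integral_interval(1)[OF cont_g g_le B])
  have coeffG: "integral ?I (\<lambda>y. G y * cos (of_nat k * (2 * pi * y))) = a * E k * cos (2 * pi * of_nat k * x0)" for k :: nat
  proof -
    let ?c = "\<lambda>y. cos (of_nat k * (2 * pi * y))"
    define h where "h z = \<phi> (x0 + z) * ?c z" for z
    have cont_h: "continuous_on S h" for S
      unfolding h_def by (intro continuous_intros cont_\<phi>)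
    have int_h: "h integrable_on {u..v}" for u v
      by (intro integrable_continuous_interval cont_h)
    have le: "\<bar>g m y * ?c y\<bar> \<le> B m" if "y \<in> ?I" for m y
      using mult_mono[OF g_le[OF that, of m] abs_cos_le_one[of "of_nat k * (2 * pi * y)"]]
      by (simp add: abs_mult B_def)
    have "(\<lambda>N. \<Sum>m<N. integral ?I (\<lambda>y. g m y * ?c y)) \<longlonglongrightarrow> integral ?I (\<lambda>y. \<Sum>m. g m y * ?c y)"
      by (rule suminf_integral_interval(2)[OF _ le B]) (intro continuous_intros cont_g)
    also have "integral ?I (\<lambda>y. \<Sum>m. g m y * ?c y) = integral ?I (\<lambda>y. G y * ?c y)"
      unfolding G_def by (intro integral_cong suminf_mult2[symmetric] sg)
    \<comment> \<open>Unfolding: term m covers the unit intervals centred at - m and m + 1, and the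
      first N terms tile [1/2 - N, 1/2 + N].\<close>
    also have "(\<lambda>N. \<Sum>m<N. integral ?I (\<lambda>y. g m y * ?c y)) = (\<lambda>N. integral {1/2 - real N..1/2 + real N} h)"
    proof
      fix N show "(\<Sum>m<N. integral ?I (\<lambda>y. g m y * ?c y)) = integral {1/2 - real N..1/2 + real N} h"
      proof (induction N)
        case (Suc N)
        have c: "?c (y + of_int j) = ?c y" for y j
        proof -
          have "of_nat k * (2 * pi * (y + of_int j)) = of_nat k * (2 * pi * y) + 2 * pi * of_int (int k * j)"
            by (simp add: algebra_simps)
          then show ?thesis
            by (simp only: cos_add[of _ "2 * pi * of_int (int k * j)"] sin_int_2pin cos_int_2pin mult_1_right mult_zero_right diff_0_right)
        qed
        have "g N y * ?c y = (h \<circ> ((+) (- real N))) y + (h \<circ> ((+) (1 + real N))) y" for y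
          using c[of y "- int N"] c[of y "1 + int N"]
          by (simp add: g_def h_def algebra_simps)
        then have "integral ?I (\<lambda>y. g N y * ?c y) =
          integral ?I (h \<circ> ((+) (- real N))) + integral ?I (h \<circ> ((+) (1 + real N)))"
          by (simp only:) (intro integral_add integrable_continuous_interval continuous_on_compose cont_h continuous_intros)
        also have "\<dots> = integral {-1/2 + - real N..1/2 + - real N} h + integral {-1/2 + (1 + real N)..1/2 + (1 + real N)} h"
          by (simp only: integral_shift_Icc_real)
        finally have "(\<Sum>m<Suc N. integral ?I (\<lambda>y. g m y * ?c y)) =
          integral {1/2 - real (Suc N)..1/2 - real N} h + integral {1/2 - real N..1/2 + real N} h
            + integral {1/2 + real N..1/2 + real (Suc N)} h"
          using Suc by (simp add: algebra_simps)
        also have "\<dots> = integral {1/2 - real (Suc N)..1/2 + real (Suc N)} h"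
          using Henstock_Kurzweil_Integration.integral_combine[where a = "1/2 - real (Suc N)" and c = "1/2 - real N" and b = "1/2 + real N" and f = h]
            Henstock_Kurzweil_Integration.integral_combine[where a = "1/2 - real (Suc N)" and c = "1/2 + real N" and b = "1/2 + real (Suc N)" and f = h] int_h
          by simp
        finally show ?case .
      qed simp
    qed
    finally have 1: "(\<lambda>N. integral {1/2 - real N..1/2 + real N} h) \<longlonglongrightarrow> integral ?I (\<lambda>y. G y * ?c y)" .
    have h_shift: "h (- x0 + 1 * z) = exp (- s * z\<^sup>2) * cos (2 * pi * of_nat k * z - 2 * pi * of_nat k * x0)" for z
      by (simp add: h_def \<phi>_def algebra_simps)
    have "integrable lborel (\<lambda>z. exp (- s * z\<^sup>2) * cos (2 * pi * of_nat k * z - 2 * pi * of_nat k * x0))"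
      by (rule Bochner_Integration.integrable_bound[OF gaussian_fourier(1)[OF s]])
         (auto simp: abs_mult)
    then have "integrable lborel h"
      using lborel_integrable_real_affine_iff[of 1 h "- x0"] unfolding h_shift by simp
    from integral_symmetric_interval_tendsto[OF this]
    have "(\<lambda>N. integral {1/2 - real N..1/2 + real N} h) \<longlonglongrightarrow> (LBINT z. h z)" .
    with 1 have "integral ?I (\<lambda>y. G y * ?c y) = (LBINT z. h z)"
      by (rule LIMSEQ_unique)
    also have "\<dots> = (LBINT z. h (- x0 + 1 * z))"
      using lborel_integral_real_affine[of 1 h "- x0"] by simp
    also have "\<dots> = sqrt (pi / s) * exp (- (2 * pi * of_nat k)\<^sup>2 / (4 * s)) * cos (2 * pi * of_nat k * x0)"
      unfolding h_shift using gaussian_fourier(2)[OF s] by simp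
    also have "- (2 * pi * of_nat k)\<^sup>2 / (4 * s) = - (pi\<^sup>2 / s) * (real k)\<^sup>2"
      by (simp add: power2_eq_square)
    finally show ?thesis by (simp add: a_def E_def)
  qed
  define f where "f l y = E l * cos (2 * pi * of_nat l * (x0 + y))" for l y
  have E: "summable E"
    unfolding E_def using summable_gauss[of "pi\<^sup>2 / s" 0 0] s by simp
  have f_le: "\<bar>f l y\<bar> \<le> E l" for l y
    by (simp add: f_def abs_mult E_def)
  have cont_f: "continuous_on S (f l)" for S l
    unfolding f_def by (intro continuous_intros)
  have sf: "summable (\<lambda>l. f l y)" for y
    using f_le by (intro summable_comparison_test[OF _ E]) auto
  define F where "F y = a * (2 * (\<Sum>l. f l y) - 1)" for y
  have cont_sumf: "continuous_on ?I (\<lambda>y. \<Sum>l. f l y)"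
    by (rule suminf_integral_interval(1)[OF cont_f f_le E])
  then have contF: "continuous_on ?I F"
    unfolding F_def by (intro continuous_intros)
  have coeffF: "integral ?I (\<lambda>y. F y * cos (of_nat k * (2 * pi * y))) = a * E k * cos (2 * pi * of_nat k * x0)" for k :: nat
  proof -
    let ?c = "\<lambda>y. cos (of_nat k * (2 * pi * y))"
    define J where "J = (if k = 0 then 1 else cos (2 * pi * of_nat k * x0) / 2)"
    have le: "\<bar>f m y * ?c y\<bar> \<le> E m" for m y
      using mult_mono[OF f_le[of m y] abs_cos_le_one[of "of_nat k * (2 * pi * y)"]]
      by (simp add: abs_mult E_def)
    have "(\<lambda>N. \<Sum>l<N. integral ?I (\<lambda>y. f l y * ?c y)) \<longlonglongrightarrow> integral ?I (\<lambda>y. \<Sum>l. f l y * ?c y)"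
      by (rule suminf_integral_interval(2)[OF _ le E]) (intro continuous_intros cont_f)
    also have "integral ?I (\<lambda>y. \<Sum>l. f l y * ?c y) = integral ?I (\<lambda>y. (\<Sum>l. f l y) * ?c y)"
      by (intro integral_cong suminf_mult2[symmetric] sf)
    finally have 1: "(\<lambda>N. \<Sum>l<N. integral ?I (\<lambda>y. f l y * ?c y)) \<longlonglongrightarrow> integral ?I (\<lambda>y. (\<Sum>l. f l y) * ?c y)" .
    have "integral ?I (\<lambda>y. f l y * ?c y) = (if l = k then E k * J else 0)" for l
      using cos_mult_cos_period[of l x0 k] by (simp add: f_def mult.assoc J_def)
    then have "(\<Sum>l<N. integral ?I (\<lambda>y. f l y * ?c y)) = E k * J" if "k < N" for N
      using that by simp
    then have "(\<lambda>N. \<Sum>l<N. integral ?I (\<lambda>y. f l y * ?c y)) \<longlonglongrightarrow> E k * J"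
      by (intro tendsto_eventually eventually_mono[OF eventually_gt_at_top[of k]])
    with 1 have "integral ?I (\<lambda>y. (\<Sum>l. f l y) * ?c y) = E k * J"
      by (rule LIMSEQ_unique)
    moreover have "integral ?I ?c = (if k = 0 then 1 else 0)"
      using cos_mult_cos_period[of 0 0 k] by (simp split: if_splits)
    moreover have "(\<lambda>y. (\<Sum>l. f l y) * ?c y) integrable_on ?I" "?c integrable_on ?I"
      by (intro integrable_continuous_interval continuous_intros cont_sumf)+
    moreover have "F y * ?c y = (2 * a) * ((\<Sum>l. f l y) * ?c y) - a * ?c y" for y
      by (simp add: F_def algebra_simps)
    ultimately have "((\<lambda>y. F y * ?c y) has_integral 2 * a * (E k * J) - a * (if k = 0 then 1 else 0)) ?I"
      by (simp only:) (intro has_integral_diff has_integral_mult_right, simp_all only: has_integral_iff)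
    then have "integral ?I (\<lambda>y. F y * ?c y) = 2 * a * (E k * J) - a * (if k = 0 then 1 else 0)"
      by (rule integral_unique)
    then show ?thesis by (auto simp: J_def E_def)
  qed
  have "G 0 - F 0 = 0"
  proof (rule eq_0_if_cos_coeffs_eq_0[where D = "\<lambda>y. G y - F y"])
    show "continuous_on ?I (\<lambda>y. G y - F y)"
      by (intro continuous_intros contG contF)
    fix k :: nat
    let ?c = "\<lambda>y. cos (of_nat k * (2 * pi * y))"
    have "(\<lambda>y. G y * ?c y) integrable_on ?I" "(\<lambda>y. F y * ?c y) integrable_on ?I"
      by (intro integrable_continuous_interval continuous_intros contG contF)+
    then show "integral ?I (\<lambda>y. (G y - F y) * ?c y) = 0"
      using coeffG[of k] coeffF[of k]
      by (simp add: left_diff_distrib Henstock_Kurzweil_Integration.integral_diff)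
  qed
  then show ?thesis
    by (simp add: G_def F_def g_def f_def \<phi>_def a_def E_def)
qed

text \<open>Completing the square at the shift p / (2 s) turns translated Gaussians into exp (p m -
  s m^2), and p pairs with - p to a cosh. On the dual side the prefactor carries all growth in
  \<open>p\<close>, while the cosines stay bounded.\<close>

lemma theta_transformation:
  fixes s p :: real
  assumes s: "s > 0"
  shows "2 * (\<Sum>m. exp (- s * (real m)\<^sup>2) * cosh (real m * p)) - 1 =
    sqrt (pi / s) * exp (p\<^sup>2 / (4 * s)) * (2 * (\<Sum>k. exp (- (pi\<^sup>2 / s) * (real k)\<^sup>2) * cos (pi / s * real k * p)) - 1)"
proof -
  define x0 where "x0 = p / (2 * s)"
  define A where "A c m = exp (c * real m - s * (real m)\<^sup>2)" for c m
  have sA: "summable (A c)" for c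
    using summable_gauss[OF s, of 0 c] by (simp add: A_def[abs_def])
  have e: "exp (p\<^sup>2 / (4 * s)) * (exp (- s * (x0 - real m)\<^sup>2) + exp (- s * (x0 + 1 + real m)\<^sup>2)) =
    A p m + A (- p) (Suc m)" for m
  proof -
    have "p\<^sup>2 / (4 * s) + - s * (x0 - real m)\<^sup>2 = p * real m - s * (real m)\<^sup>2"
      "p\<^sup>2 / (4 * s) + - s * (x0 + 1 + real m)\<^sup>2 = - p * real (Suc m) - s * (real (Suc m))\<^sup>2"
      using s by (simp_all add: x0_def power2_eq_square field_simps)
    then show ?thesis
      unfolding A_def distrib_left exp_add[symmetric] by simp
  qed
  have "summable (\<lambda>m. exp (- s * (x0 - real m)\<^sup>2) + exp (- s * (x0 + 1 + real m)\<^sup>2))"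
  proof -
    have "summable (\<lambda>m. exp (- (p\<^sup>2 / (4 * s))) * (A p m + A (- p) (Suc m)))"
      by (intro summable_mult summable_add sA) (use sA[of "- p"] in \<open>simp add: summable_Suc_iff\<close>)
    then show ?thesis
      unfolding e[symmetric] by (simp add: mult.assoc[symmetric] exp_add[symmetric])
  qed
  then have "exp (p\<^sup>2 / (4 * s)) * (\<Sum>m. exp (- s * (x0 - real m)\<^sup>2) + exp (- s * (x0 + 1 + real m)\<^sup>2)) =
     (\<Sum>m. A p m + A (- p) (Suc m))"
    unfolding e[symmetric] by (rule suminf_mult[symmetric])
  also have "\<dots> = (\<Sum>m. A p m) + (\<Sum>m. A (- p) (Suc m))"
    using sA[of p] sA[of "- p"] by (intro suminf_add[symmetric]) (simp_all add: summable_Suc_iff)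
  \<comment> \<open>These translates start at m = 1; completing them by the term at 0 costs the 1
    subtracted in the statement.\<close>
  also have "(\<Sum>m. A (- p) (Suc m)) = (\<Sum>m. A (- p) m) - 1"
    using suminf_split_head[OF sA[of "- p"]] by (simp add: A_def[of _ 0])
  also have "(\<Sum>m. A p m) + ((\<Sum>m. A (- p) m) - 1) = (\<Sum>m. A p m + A (- p) m) - 1"
    using suminf_add[OF sA[of p] sA[of "- p"]] by simp
  also have "(\<Sum>m. A p m + A (- p) m) = (\<Sum>m. 2 * (exp (- s * (real m)\<^sup>2) * cosh (real m * p)))"
    by (simp add: A_def cosh_def algebra_simps flip: exp_add)
  also have "\<dots> = 2 * (\<Sum>m. exp (- s * (real m)\<^sup>2) * cosh (real m * p))"
  proof (rule suminf_mult)
    have "summable (\<lambda>m. (1/2) * (A p m + A (- p) m))"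
      by (intro summable_mult summable_add sA)
    then show "summable (\<lambda>m. exp (- s * (real m)\<^sup>2) * cosh (real m * p))"
      by (simp add: A_def cosh_def algebra_simps flip: exp_add)
  qed
  finally show ?thesis
    unfolding theta_transformation_aux[OF s] using s by (simp add: x0_def algebra_simps)
qed

section \<open>Termwise derivatives and the uniform estimate\<close>

lemma DERIV_suminf_bounded:
  fixes f f' :: "nat \<Rightarrow> real \<Rightarrow> real"
  assumes "\<And>n x. (f n has_real_derivative f' n x) (at x)"
    and "\<And>n x. x \<in> ball p 1 \<Longrightarrow> \<bar>f' n x\<bar> \<le> B n" and "summable B"
    and "summable (\<lambda>n. f n p)"
  shows "((\<lambda>x. \<Sum>n. f n x) has_real_derivative (\<Sum>n. f' n p)) (at p)"
proof (rule has_field_derivative_series'(2)[where S = "ball p 1"])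
  show "uniformly_convergent_on (ball p 1) (\<lambda>n x. \<Sum>i<n. f' i x)"
    by (rule Weierstrass_m_test'[OF _ assms(3)]) (use assms(2) in auto)
qed (use assms in \<open>auto intro: has_field_derivative_at_within\<close>)

lemma abs_cosh_sinh_le:
  fixes x y :: real
  assumes "\<bar>x\<bar> \<le> y"
  shows "\<bar>cosh x\<bar> \<le> exp y" "\<bar>sinh x\<bar> \<le> exp y"
proof -
  have e: "exp x \<le> exp y" "exp (- x) \<le> exp y" "0 < exp x" "0 < exp (- x)"
    using assms by auto
  have "\<bar>cosh x\<bar> \<le> exp y \<and> \<bar>sinh x\<bar> \<le> exp y"
  proof -
    have "\<bar>(a + b) / 2\<bar> \<le> c \<and> \<bar>(a - b) / 2\<bar> \<le> c" if "a \<le> c" "b \<le> c" "0 < a" "0 < b" for a b c :: real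
      using that by (auto simp: abs_le_iff)
    from this[OF e] show ?thesis
      unfolding cosh_field_def sinh_field_def .
  qed
  then show "\<bar>cosh x\<bar> \<le> exp y" "\<bar>sinh x\<bar> \<le> exp y"
    by simp_all
qed

lemma gauss_hyperbolic_bound:
  fixes x p s :: real
  assumes "x \<in> ball p 1"
  shows "\<bar>real m ^ j * exp (- s * (real m)\<^sup>2) * cosh (real m * x)\<bar> \<le> real m ^ j * exp ((\<bar>p\<bar> + 1) * real m - s * (real m)\<^sup>2)"
    "\<bar>real m ^ j * exp (- s * (real m)\<^sup>2) * sinh (real m * x)\<bar> \<le> real m ^ j * exp ((\<bar>p\<bar> + 1) * real m - s * (real m)\<^sup>2)"
proof -
  have x: "\<bar>x\<bar> \<le> \<bar>p\<bar> + 1"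
    using assms by (auto simp: dist_real_def)
  have "\<bar>real m * x\<bar> \<le> (\<bar>p\<bar> + 1) * real m"
    using mult_right_mono[OF x, of "real m"] by (simp add: abs_mult mult.commute)
  note * = abs_cosh_sinh_le[OF this]
  have e: "exp ((\<bar>p\<bar> + 1) * real m - s * (real m)\<^sup>2) = exp (- s * (real m)\<^sup>2) * exp ((\<bar>p\<bar> + 1) * real m)"
    by (simp flip: exp_add)
  show "\<bar>real m ^ j * exp (- s * (real m)\<^sup>2) * cosh (real m * x)\<bar> \<le> real m ^ j * exp ((\<bar>p\<bar> + 1) * real m - s * (real m)\<^sup>2)"
    "\<bar>real m ^ j * exp (- s * (real m)\<^sup>2) * sinh (real m * x)\<bar> \<le> real m ^ j * exp ((\<bar>p\<bar> + 1) * real m - s * (real m)\<^sup>2)"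
    unfolding e abs_mult mult.assoc using * by (auto intro!: mult_left_mono)
qed

lemma summable_gauss_hyperbolic:
  fixes s p :: real
  assumes "s > 0"
  shows "summable (\<lambda>m. real m ^ j * exp (- s * (real m)\<^sup>2) * cosh (real m * p))"
    "summable (\<lambda>m. real m ^ j * exp (- s * (real m)\<^sup>2) * sinh (real m * p))"
  by (rule summable_comparison_test[OF _ summable_gauss[OF assms, of j "\<bar>p\<bar> + 1"]],
      use gauss_hyperbolic_bound[of p p] in auto)+

text \<open>The first formula differentiates the theta transformation; the second serves p = 0,
  where the quotient by \<open>p\<close> becomes a derivative.\<close>

lemma DERIV_gauss_hyperbolic:
  fixes s p :: real
  assumes "s > 0"
  shows "((\<lambda>p. \<Sum>m. exp (- s * (real m)\<^sup>2) * cosh (real m * p)) has_real_derivative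
      (\<Sum>m. real m * exp (- s * (real m)\<^sup>2) * sinh (real m * p))) (at p)"
    "((\<lambda>p. \<Sum>m. real m * exp (- s * (real m)\<^sup>2) * sinh (real m * p)) has_real_derivative
      (\<Sum>m. (real m)\<^sup>2 * exp (- s * (real m)\<^sup>2) * cosh (real m * p))) (at p)"
  using summable_gauss_hyperbolic[OF assms, of 0 p] summable_gauss_hyperbolic[OF assms, of 1 p]
    gauss_hyperbolic_bound[of _ p _ 1 s] gauss_hyperbolic_bound[of _ p _ 2 s]
  by (intro DERIV_suminf_bounded[OF _ _ summable_gauss[OF assms, of 1 "\<bar>p\<bar> + 1"]]
      DERIV_suminf_bounded[OF _ _ summable_gauss[OF assms, of 2 "\<bar>p\<bar> + 1"]];
      auto intro!: derivative_eq_intros simp: power2_eq_square)+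

lemma DERIV_gauss_cos:
  fixes s c p :: real
  assumes "s > 0"
  shows "((\<lambda>p. \<Sum>m. exp (- s * (real m)\<^sup>2) * cos (c * real m * p)) has_real_derivative
      (\<Sum>m. - (c * real m * exp (- s * (real m)\<^sup>2) * sin (c * real m * p)))) (at p)"
proof (rule DERIV_suminf_bounded)
  have *: "summable (\<lambda>m. real m ^ j * exp (- s * (real m)\<^sup>2))" for j
    using summable_gauss[OF assms, of j 0] by simp
  show "summable (\<lambda>m. \<bar>c\<bar> * (real m * exp (- s * (real m)\<^sup>2)))"
    using *[of 1] by (intro summable_mult) simp
  show "summable (\<lambda>n. exp (- s * (real n)\<^sup>2) * cos (c * real n * p))"
    by (rule summable_comparison_test[OF _ *[of 0]]) (auto simp: abs_mult)
  show "((\<lambda>p. exp (- s * (real m)\<^sup>2) * cos (c * real m * p)) has_real_derivative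
      - (c * real m * exp (- s * (real m)\<^sup>2) * sin (c * real m * x))) (at x)" for m x
    by (auto intro!: derivative_eq_intros)
  show "\<bar>- (c * real m * exp (- s * (real m)\<^sup>2) * sin (c * real m * x))\<bar> \<le> \<bar>c\<bar> * (real m * exp (- s * (real m)\<^sup>2))" for m x
    using abs_sin_le_one[of "c * real m * x"] by (simp add: abs_mult mult_left_le mult.assoc[symmetric])
qed

text \<open>Half of the exponent pays for the linear factor, by u \<le> exp (u / 2); this halving
  fixes the final rate.\<close>

lemma exp_minus_bound: "u * exp (- u) \<le> exp (- u / 2)" for u :: real
proof -
  have "u \<le> exp (u / 2)"
  proof (cases "u \<ge> 0")
    case True
    have "u \<le> 1 + u / 2 + (u / 2)\<^sup>2 / 2"
      using zero_le_power2[of "u / 2 - 1"] by (simp add: power2_eq_square field_simps)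
    also have "\<dots> \<le> exp (u / 2)"
      using exp_lower_Taylor_quadratic[of "u / 2"] True by simp
    finally show ?thesis .
  qed (use exp_gt_zero[of "u / 2"] in linarith)
  then have "u * exp (- u) \<le> exp (u / 2) * exp (- u)"
    by (intro mult_right_mono) auto
  then show ?thesis by (simp flip: exp_add)
qed

text \<open>
  This compares the derivatives in \<open>p\<close> of both sides of the theta transformation; the bound
  \<open>\<bar>sin x\<bar> \<le> \<bar>x\<bar>\<close> absorbs the division by \<open>p\<close>, which makes the estimate uniform.
\<close>

lemma gauss_sinhc_sum_approx_aux:
  fixes s p :: real
  assumes s: "0 < s" "s \<le> 1" and p: "p \<noteq> 0"
  defines "K \<equiv> sqrt (pi / s) / (4 * s) * exp (p\<^sup>2 / (4 * s))"
  shows "\<bar>(\<Sum>m. real m * exp (- s * (real m)\<^sup>2) * sinh (real m * p)) / p - K\<bar> \<le> 12 * exp (- (pi\<^sup>2 / (2 * s))) * K"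
proof -
  define u where "u = pi\<^sup>2 / s"
  \<comment> \<open>The bound 2 makes the ratio \<open>r\<close> of the geometric majorant at most
    1/2.\<close>
  have u: "u > 0" "u \<ge> 2"
  proof -
    have "2 * s \<le> 3\<^sup>2" using s by simp
    also have "3\<^sup>2 \<le> pi\<^sup>2" using pi_gt3 by (intro power_mono) auto
    finally show "u \<ge> 2" using s by (simp add: u_def field_simps)
    then show "u > 0" by simp
  qed
  define E where "E k = exp (- u * (real k)\<^sup>2)" for k
  define c where "c = pi / s"
  define C where "C = (\<Sum>k. E k * cos (c * real k * p))"
  define S where "S = (\<Sum>k. - (c * real k * E k * sin (c * real k * p)))"
  define M where "M = (\<Sum>m. real m * exp (- s * (real m)\<^sup>2) * sinh (real m * p))"
  define a where "a = sqrt (pi / s)"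
  define e where "e = exp (p\<^sup>2 / (4 * s))"
  have "((\<lambda>p. 2 * (\<Sum>m. exp (- s * (real m)\<^sup>2) * cosh (real m * p)) - 1) has_real_derivative 2 * M) (at p)"
    using DERIV_diff[OF DERIV_cmult[OF DERIV_gauss_hyperbolic(1)[OF s(1)], of 2] DERIV_const[of 1]]
    unfolding M_def by simp
  moreover have "((\<lambda>p. sqrt (pi / s) * exp (p\<^sup>2 / (4 * s)) *
      (2 * (\<Sum>k. exp (- (pi\<^sup>2 / s) * (real k)\<^sup>2) * cos (pi / s * real k * p)) - 1)) has_real_derivative
      a * (e * (p / (2 * s))) * (2 * C - 1) + a * e * (2 * S)) (at p)"
  proof -
    have "((\<lambda>p. \<Sum>k. exp (- (pi\<^sup>2 / s) * (real k)\<^sup>2) * cos (pi / s * real k * p)) has_real_derivative S) (at p)"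
      using DERIV_gauss_cos[OF u(1), of c p] unfolding S_def E_def u_def c_def .
    moreover have "((\<lambda>p. sqrt (pi / s) * exp (p\<^sup>2 / (4 * s))) has_real_derivative a * (e * (p / (2 * s)))) (at p)"
      using s by (auto intro!: derivative_eq_intros simp: a_def e_def)
    from DERIV_mult[OF this DERIV_diff[OF DERIV_cmult[OF calculation, of 2] DERIV_const[of 1]]]
    show ?thesis
      by (simp add: C_def E_def u_def c_def a_def e_def mult_ac)
  qed
  ultimately have "2 * M = a * (e * (p / (2 * s))) * (2 * C - 1) + a * e * (2 * S)"
    unfolding theta_transformation[OF s(1)] by (rule DERIV_unique)
  then have M: "M / p = K * (2 * C - 1 + (4 * s / p) * S)"
    using s p by (simp add: K_def a_def e_def field_simps)
  have sE: "summable (\<lambda>k. real k ^ j * E k)" for j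
    unfolding E_def using summable_gauss[OF u(1), of j 0] by simp
  have sC: "summable (\<lambda>k. E k * cos (c * real k * p))"
    by (rule summable_comparison_test[OF _ sE[of 0]]) (auto simp: abs_mult E_def)
  have sS: "summable (\<lambda>k. - (c * real k * E k * sin (c * real k * p)))"
  proof -
    have "summable (\<lambda>k. real k * E k * sin (c * real k * p))"
      by (rule summable_comparison_test[OF _ sE[of 1]]) (auto simp: abs_mult E_def mult_left_le)
    from summable_mult[OF this, of "- c"] show ?thesis
      by (simp add: mult.assoc)
  qed
  \<comment> \<open>Frequency 0 contributes exactly 1 to 2 C - 1 and nothing to \<open>S\<close>, so
    the error consists of the frequencies from 1 on.\<close>
  define d where "d k = 2 * (E (Suc k) * cos (c * real (Suc k) * p)) +
    (4 * s / p) * (- (c * real (Suc k) * E (Suc k) * sin (c * real (Suc k) * p)))" for k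
  have "d sums (2 * (C - 1) + (4 * s / p) * S)"
  proof -
    have "(\<lambda>k. E (Suc k) * cos (c * real (Suc k) * p)) sums (C - 1)"
      using summable_sums[OF sC] sums_Suc_iff[of "\<lambda>k. E k * cos (c * real k * p)" "C - 1"]
      by (simp add: C_def E_def[of 0])
    moreover have "(\<lambda>k. - (c * real (Suc k) * E (Suc k) * sin (c * real (Suc k) * p))) sums S"
      using summable_sums[OF sS] sums_Suc_iff[of "\<lambda>k. - (c * real k * E k * sin (c * real k * p))" S]
      by (simp add: S_def)
    ultimately show ?thesis
      unfolding d_def by (intro sums_add sums_mult)
  qed
  then have d_sum: "2 * C - 1 + (4 * s / p) * S = 1 + suminf d"
    by (simp add: sums_iff)
  define r where "r = exp (- (u / 2))"
  have r: "0 < r" "r \<le> 1/2"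
  proof -
    have "exp 1 \<le> exp (u / 2)" using u by simp
    moreover have "2 \<le> exp (1::real)" using exp_ge_add_one_self[of 1] by simp
    ultimately have "2 \<le> exp (u / 2)" by linarith
    then show "r \<le> 1/2" by (simp add: r_def exp_minus field_simps)
  qed (simp add: r_def)
  \<comment> \<open>The 6 is 2 from the cosine term plus 4 from the sine term.\<close>
  have d_le: "\<bar>d k\<bar> \<le> 6 * r * r ^ k" for k
  proof -
    define n where "n = real (Suc k)"
    have n: "n \<ge> 1" "n > 0" by (auto simp: n_def)
    have E_n: "E (Suc k) = exp (- u * n\<^sup>2)" by (simp add: E_def n_def)
    have "\<bar>sin (c * n * p)\<bar> \<le> c * n * \<bar>p\<bar>"
      using abs_sin_x_le_abs_x[of "c * n * p"] s n by (simp add: abs_mult c_def)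
    then have "\<bar>(4 * s / p) * (- (c * n * E (Suc k) * sin (c * n * p)))\<bar> \<le>
        (4 * s / \<bar>p\<bar>) * (c * n * E (Suc k) * (c * n * \<bar>p\<bar>))"
      unfolding abs_mult abs_minus_cancel using s n p by (intro mult_mono) (auto simp: c_def E_n)
    also have "\<dots> = 4 * ((u * n\<^sup>2) * exp (- (u * n\<^sup>2)))"
      using s p by (simp add: c_def u_def E_n power2_eq_square field_simps)
    also have "\<dots> \<le> 4 * exp (- (u * n\<^sup>2) / 2)"
      using exp_minus_bound[of "u * n\<^sup>2"] by simp
    finally have 1: "\<bar>(4 * s / p) * (- (c * n * E (Suc k) * sin (c * n * p)))\<bar> \<le> 4 * exp (- (u * n\<^sup>2) / 2)" .
    have "\<bar>2 * (E (Suc k) * cos (c * n * p))\<bar> \<le> 2 * exp (- (u * n\<^sup>2))"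
      by (simp add: abs_mult E_n)
    also have "\<dots> \<le> 2 * exp (- (u * n\<^sup>2) / 2)"
      using u n by simp
    finally have 2: "\<bar>2 * (E (Suc k) * cos (c * n * p))\<bar> \<le> 2 * exp (- (u * n\<^sup>2) / 2)" .
    have "\<bar>d k\<bar> \<le> \<bar>2 * (E (Suc k) * cos (c * n * p))\<bar> + \<bar>(4 * s / p) * (- (c * n * E (Suc k) * sin (c * n * p)))\<bar>"
      unfolding d_def n_def by (rule abs_triangle_ineq)
    with 1 2 have "\<bar>d k\<bar> \<le> 6 * exp (- (u * n\<^sup>2) / 2)"
      by linarith
    also have "exp (- (u * n\<^sup>2) / 2) \<le> exp (- (u * n) / 2)"
      using u n by (simp add: power2_eq_square)
    also have "\<dots> = r * r ^ k"
    proof -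
      have "- (u * n) / 2 = - (u / 2) + real k * (- (u / 2))"
        by (simp add: n_def field_simps)
      then show ?thesis by (simp only: r_def exp_add exp_of_nat_mult)
    qed
    finally show ?thesis by simp
  qed
  have geo: "summable (\<lambda>k. 6 * r * r ^ k)"
    using r by (intro summable_mult summable_geometric) auto
  have "\<bar>suminf d\<bar> \<le> (\<Sum>k. 6 * r * r ^ k)"
    using norm_suminf_le[OF _ geo, of d] d_le by simp
  also have "\<dots> = 6 * r / (1 - r)"
    using r by (subst suminf_mult) (auto simp: suminf_geometric intro!: summable_geometric)
  \<comment> \<open>Since 1 - r \<ge> 1/2, the geometric sum doubles 6 to 12.\<close>
  also have "\<dots> \<le> 12 * r"
    using r by (simp add: field_simps)
  finally have "\<bar>suminf d\<bar> \<le> 12 * r" .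
  then have "K * \<bar>suminf d\<bar> \<le> K * (12 * r)"
    using s by (intro mult_left_mono) (simp_all add: K_def)
  moreover have "M / p - K = K * suminf d"
    unfolding M d_sum by (simp add: algebra_simps)
  moreover have "K \<ge> 0" using s by (simp add: K_def)
  ultimately show ?thesis
    by (simp add: M_def abs_mult r_def u_def mult_ac)
qed

lemma gauss_sinhc_sum_approx:
  fixes s p :: real
  assumes s: "0 < s" "s \<le> 1"
  defines "K \<equiv> sqrt (pi / s) / (4 * s) * exp (p\<^sup>2 / (4 * s))"
  shows "\<bar>(\<Sum>m. (real m)\<^sup>2 * exp (- s * (real m)\<^sup>2) * sinhc (real m * p)) - K\<bar> \<le> 12 * exp (- (pi\<^sup>2 / (2 * s))) * K"
proof (cases "p = 0")
  case False
  have "(\<Sum>m. (real m)\<^sup>2 * exp (- s * (real m)\<^sup>2) * sinhc (real m * p)) =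
    (\<Sum>m. (1 / p) * (real m * exp (- s * (real m)\<^sup>2) * sinh (real m * p)))"
    using False by (intro suminf_cong) (auto simp: sinhc_def power2_eq_square)
  also have "\<dots> = (\<Sum>m. real m * exp (- s * (real m)\<^sup>2) * sinh (real m * p)) / p"
    using summable_gauss_hyperbolic(2)[OF s(1), of 1 p] by (subst suminf_mult) simp_all
  finally show ?thesis
    using gauss_sinhc_sum_approx_aux[OF s False] by (simp add: K_def)
next
  case True
  define M where "M p = (\<Sum>m. real m * exp (- s * (real m)\<^sup>2) * sinh (real m * p))" for p
  define L where "L p = sqrt (pi / s) / (4 * s) * exp (p\<^sup>2 / (4 * s))" for p
  have "(M has_real_derivative (\<Sum>m. (real m)\<^sup>2 * exp (- s * (real m)\<^sup>2))) (at 0)"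
    using DERIV_gauss_hyperbolic(2)[OF s(1), of 0] by (simp add: M_def[abs_def])
  \<comment> \<open>\<open>M\<close> vanishes at 0, so this is its difference quotient, and the
    estimate for p \<noteq> 0 passes to the limit.\<close>
  then have "((\<lambda>p. M p / p) \<longlongrightarrow> (\<Sum>m. (real m)\<^sup>2 * exp (- s * (real m)\<^sup>2))) (at 0)"
    by (simp add: has_field_derivative_iff M_def)
  moreover have "(L \<longlongrightarrow> L 0) (at 0)"
    unfolding L_def[abs_def] by (intro tendsto_intros) (use s in auto)
  ultimately have "\<bar>(\<Sum>m. (real m)\<^sup>2 * exp (- s * (real m)\<^sup>2)) - L 0\<bar> \<le> 12 * exp (- (pi\<^sup>2 / (2 * s))) * L 0"
  proof (intro tendsto_le[of "at 0" "\<lambda>p. 12 * exp (- (pi\<^sup>2 / (2 * s))) * L p" _ "\<lambda>p. \<bar>M p / p - L p\<bar>"] tendsto_intros)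
    show "\<forall>\<^sub>F p in at 0. \<bar>M p / p - L p\<bar> \<le> 12 * exp (- (pi\<^sup>2 / (2 * s))) * L p"
      unfolding eventually_at_filter M_def L_def
      by (intro always_eventually allI impI gauss_sinhc_sum_approx_aux s)
  qed auto
  then show ?thesis
    using True by (simp add: K_def L_def sinhc_def)
qed

section \<open>Coherent states\<close>

definition heat_coeff :: "real \<Rightarrow> nat \<Rightarrow> real" where
  "heat_coeff t n = real (n + 1) * exp (- t / 8 * real n * (real n + 2))"

text \<open>The squares come from pairing two coherent states, the divisor from Schur orthogonality.
  The coefficients equal those of a coherent state at time 2 t, as the semigroup law of the heat
  kernel predicts.\<close>

definition heat_series :: "real \<Rightarrow> complex \<Rightarrow> complex" where
  "heat_series t x = (\<Sum>n. of_real ((heat_coeff t n)\<^sup>2 / real (n + 1)) * cheb n x)"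

text \<open>Crude, but exponential growth in \<open>n\<close> is all that the Gaussian decay of
  \<open>heat_coeff\<close> has to beat.\<close>

lemma norm_cheb_le: "norm (cheb n x) \<le> (norm x + 1) ^ n" for x :: complex
proof (induction n rule: induct_nat_012)
  case (ge2 n)
  have "norm (cheb (Suc (Suc n)) x) \<le> norm x * (norm x + 1) ^ Suc n + (norm x + 1) ^ n"
    using norm_triangle_ineq4[of "x * cheb (Suc n) x" "cheb n x"] ge2
      mult_left_mono[OF ge2(2), of "norm x"] by (simp add: norm_mult)
  also have "\<dots> \<le> norm x * (norm x + 1) ^ Suc n + (norm x + 1) ^ Suc n"
    using power_increasing[of n "Suc n" "norm x + 1"] by simp
  also have "\<dots> = (norm x + 1) ^ Suc (Suc n)"
    by (simp add: algebra_simps)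
  finally show ?case .
qed simp_all

lemma cnj_cheb: "cnj (cheb n x) = cheb n (cnj x)"
  by (induction n rule: induct_nat_012) simp_all

lemma of_real_cheb: "of_real (cheb n x) = cheb n (of_real x :: complex)"
  by (induction n rule: induct_nat_012) simp_all

lemma summable_heat_coeff:
  assumes "t > 0" "K > 0"
  shows "summable (\<lambda>n. heat_coeff t n * K ^ n)"
proof -
  have eq: "heat_coeff t n * K ^ n =
      real n ^ 1 * exp ((ln K - t / 4) * real n - t / 8 * (real n)\<^sup>2)
      + real n ^ 0 * exp ((ln K - t / 4) * real n - t / 8 * (real n)\<^sup>2)" for n
  proof -
    have "K ^ n = exp (ln K * real n)"
      using assms by (simp add: exp_of_nat2_mult)
    then have "exp (- t / 8 * real n * (real n + 2)) * K ^ n = exp (- t / 8 * real n * (real n + 2) + ln K * real n)"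
      by (simp only: exp_add)
    also have "- t / 8 * real n * (real n + 2) + ln K * real n = (ln K - t / 4) * real n - t / 8 * (real n)\<^sup>2"
      by (simp add: power2_eq_square field_simps)
    finally show ?thesis
      by (simp add: heat_coeff_def algebra_simps)
  qed
  show ?thesis
    unfolding eq using assms by (intro summable_add summable_gauss) auto
qed

lemma heat_coeff_pos: "heat_coeff t n > 0"
  by (simp add: heat_coeff_def)

lemma cnj_heat_series: "cmod (heat_series t (cnj x)) = cmod (heat_series t x)" if "t > 0"
proof -
  have "summable (\<lambda>n. of_real ((heat_coeff t n)\<^sup>2 / real (n + 1)) * cheb n x)"
  proof (rule summable_comparison_test)
    have "norm (of_real ((heat_coeff t n)\<^sup>2 / real (n + 1)) * cheb n x) \<le> heat_coeff t n * (norm x + 1) ^ n" for n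
    proof -
      have "exp (- t / 8 * real n * (real n + 2)) \<le> 1"
        using that by simp
      then have "heat_coeff t n \<le> real (n + 1)"
        unfolding heat_coeff_def by (intro mult_left_le) auto
      from mult_right_mono[OF this, of "heat_coeff t n"]
      have "(heat_coeff t n)\<^sup>2 / real (n + 1) \<le> heat_coeff t n"
        using heat_coeff_pos[of t n] by (simp add: power2_eq_square divide_le_eq mult.commute)
      then show ?thesis
        using norm_cheb_le[of n x] heat_coeff_pos[of t n]
        unfolding norm_mult norm_of_real by (intro mult_mono) auto
    qed
    then show "\<exists>N. \<forall>n\<ge>N. norm (of_real ((heat_coeff t n)\<^sup>2 / real (n + 1)) * cheb n x) \<le> heat_coeff t n * (norm x + 1) ^ n"
      by blast
    show "summable (\<lambda>n. heat_coeff t n * (norm x + 1) ^ n)"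
      using that by (intro summable_heat_coeff) (auto intro: add_nonneg_pos)
  qed
  then have "(\<lambda>n. cnj (of_real ((heat_coeff t n)\<^sup>2 / real (n + 1)) * cheb n x)) sums cnj (heat_series t x)"
    unfolding heat_series_def by (intro summable_sums[THEN sums_cnj[THEN iffD2]])
  then have "heat_series t (cnj x) = cnj (heat_series t x)"
    unfolding heat_series_def by (simp add: sums_iff cnj_cheb)
  then show ?thesis by simp
qed

lemma coherent_state_eq: "coherent_state t g h = (\<Sum>n. of_real (heat_coeff t n) * spin_char n (g ** matrix_inv h))"
proof -
  have "(2 * (real n / 2) + 1) * exp (- t / 2 * (real n / 2) * (real n / 2 + 1)) = heat_coeff t n" for n
    by (simp add: heat_coeff_def field_simps)
  then show ?thesis
    by (simp only: coherent_state_def Let_def)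
qed

lemma dagger_SL2C: "g \<in> SL2C \<Longrightarrow> dagger g \<in> SL2C"
proof -
  have "det (dagger g) = cnj (det g)" by (simp add: det_2)
  then show "g \<in> SL2C \<Longrightarrow> dagger g \<in> SL2C" by (simp add: SL2C_def)
qed

lemma matrix_inv_in_SL2C: "g \<in> SL2C \<Longrightarrow> matrix_inv g \<in> SL2C"
  by (simp add: matrix_inv_SL2C) (simp add: SL2C_def det_2 algebra_simps)

lemma SL2C_mult: "g \<in> SL2C \<Longrightarrow> h \<in> SL2C \<Longrightarrow> g ** h \<in> SL2C"
  by (simp add: SL2C_def det_mul)

lemma dagger_image_SU2: "dagger ` SU2 \<subseteq> SL2C"
  using SU2_subset_SL2C dagger_SL2C by blast

text \<open>\<open>heat_pairing\<close> wants one factor in \<open>dagger h\<close> and the other in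
  \<open>h\<close>. The forms in \<open>h\<close> rest on traces: inversion preserves them in SL(2,
  C), and \<open>dagger\<close> conjugates them while the coefficients are real.\<close>

lemma coherent_state_SU2:
  assumes t: "t > 0" and g: "g \<in> SL2C" and h: "h \<in> SU2"
  shows "coherent_state t g h = (\<Sum>n. of_real (heat_coeff t n) * spin_char n (g ** dagger h))"
    and "coherent_state t g h = (\<Sum>n. of_real (heat_coeff t n) * spin_char n (matrix_inv g ** h))"
    and "cnj (coherent_state t g h) = (\<Sum>n. of_real (heat_coeff t n) * spin_char n (dagger g ** h))"
proof -
  have hS: "h \<in> SL2C" using h SU2_subset_SL2C by blast
  have dh: "dagger h = mat2 (h$2$2) (- h$1$2) (- h$2$1) (h$1$1)"
    using matrix_inv_SU2[OF h] matrix_inv_SL2C[OF hS] by simp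
  have char: "spin_char n A = cheb n (trace A)" if "A \<in> SL2C" for A n
    using that by (simp add: SL2C_def spin_char_eq_cheb)
  have mem: "g ** dagger h \<in> SL2C" "matrix_inv g ** h \<in> SL2C" "dagger g ** h \<in> SL2C"
    by (intro SL2C_mult g hS dagger_SL2C matrix_inv_in_SL2C)+
  show 1: "coherent_state t g h = (\<Sum>n. of_real (heat_coeff t n) * spin_char n (g ** dagger h))"
    by (simp add: coherent_state_eq matrix_inv_SU2[OF h])
  have "trace (matrix_inv g ** h) = trace (g ** dagger h)"
    unfolding dh matrix_inv_SL2C[OF g] by (simp add: trace2 mult_component2)
  then show "coherent_state t g h = (\<Sum>n. of_real (heat_coeff t n) * spin_char n (matrix_inv g ** h))"
    by (simp add: 1 char mem)
  have tr: "trace (dagger g ** h) = cnj (trace (g ** dagger h))"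
    by (simp add: trace2 mult_component2 algebra_simps)
  define x where "x = trace (g ** dagger h)"
  have "summable (\<lambda>n. of_real (heat_coeff t n) * cheb n x)"
  proof (rule summable_comparison_test)
    show "summable (\<lambda>n. heat_coeff t n * (norm x + 1) ^ n)"
      using t by (intro summable_heat_coeff) (auto intro: add_nonneg_pos)
    have "norm (of_real (heat_coeff t n) * cheb n x) \<le> heat_coeff t n * (norm x + 1) ^ n" for n
      using norm_cheb_le[of n x] heat_coeff_pos[of t n] by (simp add: norm_mult)
    then show "\<exists>N. \<forall>n\<ge>N. norm (of_real (heat_coeff t n) * cheb n x) \<le> heat_coeff t n * (norm x + 1) ^ n"
      by blast
  qed
  then have "(\<lambda>n. cnj (of_real (heat_coeff t n) * cheb n x)) sums cnj (coherent_state t g h)"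
    unfolding 1 char[OF mem(1)] x_def[symmetric] by (intro summable_sums[THEN sums_cnj[THEN iffD2]])
  then show "cnj (coherent_state t g h) = (\<Sum>n. of_real (heat_coeff t n) * spin_char n (dagger g ** h))"
    by (simp add: sums_iff char mem tr cnj_cheb x_def)
qed

text \<open>The recursion of \<open>cheb\<close> is the addition formula of sinh;
  \<open>sinhc\<close> avoids division and so includes p = 0.\<close>

lemma cheb_double_cosh: "cheb n (2 * cosh p) * sinhc p = real (n + 1) * sinhc (real (n + 1) * p)" for p :: real
proof (cases "p = 0")
  case True
  have "cheb n (2::real) = real (n + 1)"
    by (induction n rule: induct_nat_012) simp_all
  with True show ?thesis by (simp add: sinhc_def)
next
  case False
  have "cheb n (2 * cosh p) * sinh p = sinh (real (n + 1) * p)"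
  proof (induction n rule: induct_nat_012)
    case 1
    then show ?case using sinh_double[of p] by simp
  next
    case (ge2 n)
    define y where "y = real (Suc n + 1) * p"
    have e: "real (Suc (Suc n) + 1) * p = y + p" "real (n + 1) * p = y - p"
      by (simp_all add: y_def algebra_simps)
    have "cheb (Suc (Suc n)) (2 * cosh p) * sinh p = 2 * cosh p * sinh y - sinh (y - p)"
      using ge2 unfolding e y_def[symmetric] by (simp add: algebra_simps)
    also have "\<dots> = sinh (y + p)"
      by (simp add: sinh_add sinh_diff algebra_simps)
    finally show ?case unfolding e .
  qed simp
  then have "cheb n (2 * cosh p) * sinhc p = sinh (real (n + 1) * p) / p"
    using False by (simp add: sinhc_def)
  moreover have "q * sinhc (q * p) = sinh (q * p) / p" if "q \<noteq> 0" for q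
    using that False by (simp add: sinhc_def)
  ultimately show ?thesis
    by (simp del: of_nat_add of_nat_Suc)
qed

lemma heat_series_cosh:
  assumes t: "t > 0"
  shows "heat_series t (of_real (2 * cosh p)) * of_real (sinhc p) =
    of_real (exp (t / 4) * (\<Sum>m. (real m)\<^sup>2 * exp (- (t / 4) * (real m)\<^sup>2) * sinhc (real m * p)))"
proof -
  define w where "w m = (real m)\<^sup>2 * exp (- (t / 4) * (real m)\<^sup>2) * sinhc (real m * p)" for m
  have w: "summable w"
  proof (cases "p = 0")
    case True
    then show ?thesis using summable_gauss[of "t / 4" 2 0] t by (simp add: w_def[abs_def] sinhc_def)
  next
    case False
    have "w = (\<lambda>m. (1 / p) * (real m ^ 1 * exp (- (t / 4) * (real m)\<^sup>2) * sinh (real m * p)))"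
      using False by (auto simp: fun_eq_iff w_def sinhc_def power2_eq_square)
    then show ?thesis
      using summable_gauss_hyperbolic(2)[of "t / 4" 1 p] t by (simp only:) (intro summable_mult, simp)
  qed
  have w_Suc: "(heat_coeff t n)\<^sup>2 / real (n + 1) * cheb n (2 * cosh p) * sinhc p = exp (t / 4) * w (Suc n)" for n
  proof -
    \<comment> \<open>For m = n + 1 one has n (n + 2) = m^2 - 1, whence the factor exp (t /
      4).\<close>
    have "(exp (- t / 8 * real n * (real n + 2)))\<^sup>2 = exp (t / 4) * exp (- (t / 4) * (real (n + 1))\<^sup>2)"
      by (simp add: power2_eq_square field_simps flip: exp_add)
    then have "(heat_coeff t n)\<^sup>2 / real (n + 1) = real (n + 1) * (exp (t / 4) * exp (- (t / 4) * (real (n + 1))\<^sup>2))"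
      by (simp add: heat_coeff_def power_mult_distrib) (simp add: power2_eq_square)
    then have "(heat_coeff t n)\<^sup>2 / real (n + 1) * cheb n (2 * cosh p) * sinhc p =
      real (n + 1) * (exp (t / 4) * exp (- (t / 4) * (real (n + 1))\<^sup>2)) * (cheb n (2 * cosh p) * sinhc p)"
      by simp
    then show ?thesis
      unfolding cheb_double_cosh by (simp add: w_def power2_eq_square)
  qed
  have "(\<lambda>n. exp (t / 4) * w (Suc n)) sums (exp (t / 4) * suminf w)"
    using sums_Suc_iff[of w "suminf w"] summable_sums[OF w] by (intro sums_mult) (simp add: w_def)
  then have "(\<lambda>n. (exp (t / 4) * w (Suc n)) / sinhc p) sums (exp (t / 4) * suminf w / sinhc p)"
    by (rule sums_divide)
  then have "(\<lambda>n. (heat_coeff t n)\<^sup>2 / real (n + 1) * cheb n (2 * cosh p)) sums (exp (t / 4) * suminf w / sinhc p)"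
    unfolding w_Suc[symmetric] using sinhc_pos[of p] by simp
  from sums_of_real[OF this, where 'a = complex]
  have "heat_series t (of_real (2 * cosh p)) = of_real (exp (t / 4) * suminf w / sinhc p)"
    unfolding heat_series_def of_real_mult[of "_ / _"] of_real_cheb by (simp only: sums_iff)
  then show ?thesis
    using sinhc_pos[of p] unfolding w_def of_real_mult[symmetric] by simp
qed

section \<open>Haar integrals of coherent states\<close>

context
  fixes \<mu> :: "cmat2 measure"
  assumes haar: "normalized_Haar_SU2 \<mu>"
begin

text \<open>Bounded measurable \<open>F\<close> suffices, so that it can be the second series of a
  product while the first one is pulled out.\<close>

lemma integral_suminf_haar:
  fixes a :: "nat \<Rightarrow> cmat2 \<Rightarrow> complex"
  assumes a: "\<And>n. continuous_on SU2 (a n)" "\<And>n h. h \<in> SU2 \<Longrightarrow> cmod (a n h) \<le> \<alpha> n" "summable \<alpha>"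
    and F: "F \<in> borel_measurable \<mu>" "\<And>h. h \<in> SU2 \<Longrightarrow> cmod (F h) \<le> C"
  shows "(\<integral>h. (\<Sum>n. a n h) * F h \<partial>\<mu>) = (\<Sum>n. \<integral>h. a n h * F h \<partial>\<mu>)"
proof -
  interpret prob_space \<mu> by (rule prob_space_haar[OF haar])
  note space = space_haar[OF haar]
  have sa: "summable (\<lambda>n. a n h)" if "h \<in> SU2" for h
    using a(2)[OF that] by (intro summable_comparison_test[OF _ a(3)]) auto
  have bound: "cmod (a n h * F h) \<le> \<alpha> n * C" if "h \<in> SU2" for n h
    unfolding norm_mult using a(2)[OF that, of n] F(2)[OF that] order_trans[OF norm_ge_zero a(2)[OF that, of n]]
    by (intro mult_mono) auto
  have int: "integrable \<mu> (\<lambda>h. a n h * F h)" for n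
    using bound by (intro integrable_haar_bounded[OF haar] borel_measurable_times borel_measurable_haar[OF haar] a F)
  have sC: "summable (\<lambda>n. \<alpha> n * C)" by (intro summable_mult2 a)
  have "(\<integral>h. (\<Sum>n. a n h) * F h \<partial>\<mu>) = (\<integral>h. (\<Sum>n. a n h * F h) \<partial>\<mu>)"
    by (intro Bochner_Integration.integral_cong refl suminf_mult2 sa) (simp add: space)
  also have "\<dots> = (\<Sum>n. \<integral>h. a n h * F h \<partial>\<mu>)"
  proof (rule integral_suminf)
    show "AE h in \<mu>. summable (\<lambda>n. norm (a n h * F h))"
      using bound by (intro AE_I2 summable_comparison_test[OF _ sC]) (auto simp: space)
    show "summable (\<lambda>n. \<integral>h. norm (a n h * F h) \<partial>\<mu>)"
    proof (rule summable_comparison_test[OF _ sC], intro exI allI impI)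
      fix n
      have "(\<integral>h. norm (a n h * F h) \<partial>\<mu>) \<le> (\<integral>h. \<alpha> n * C \<partial>\<mu>)"
        using bound int by (intro integral_mono) (auto simp: space)
      then show "norm (\<integral>h. norm (a n h * F h) \<partial>\<mu>) \<le> \<alpha> n * C"
        by (simp add: prob_space)
    qed
  qed (rule int)
  finally show ?thesis .
qed

text \<open>Compactness of SU(2) bounds the trace, and \<open>norm_cheb_le\<close> turns this into a
  majorant; \<open>f\<close> will be the identity or \<open>dagger\<close>.\<close>

lemma heat_series_bound:
  assumes t: "t > 0" and A: "A \<in> SL2C" and f: "continuous_on SU2 f" "f ` SU2 \<subseteq> SL2C"
  obtains \<alpha> where "summable \<alpha>" "\<And>n h. h \<in> SU2 \<Longrightarrow> cmod (of_real (heat_coeff t n) * spin_char n (A ** f h)) \<le> \<alpha> n"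
    "\<And>n. continuous_on SU2 (\<lambda>h. of_real (heat_coeff t n) * spin_char n (A ** f h))"
proof -
  have "continuous_on SU2 (\<lambda>h. trace (A ** f h))"
    by (intro continuous_intros f)
  then obtain K where K: "\<And>h. h \<in> SU2 \<Longrightarrow> cmod (trace (A ** f h)) \<le> K"
    using bounded_on_SU2 by blast
  show ?thesis
  proof (rule that[of "\<lambda>n. heat_coeff t n * (\<bar>K\<bar> + 1) ^ n"])
    show "summable (\<lambda>n. heat_coeff t n * (\<bar>K\<bar> + 1) ^ n)"
      using t by (intro summable_heat_coeff) auto
    show "cmod (of_real (heat_coeff t n) * spin_char n (A ** f h)) \<le> heat_coeff t n * (\<bar>K\<bar> + 1) ^ n" if h: "h \<in> SU2" for n h
    proof -
      have "A ** f h \<in> SL2C" using f h by (intro SL2C_mult A) auto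
      then have "spin_char n (A ** f h) = cheb n (trace (A ** f h))"
        by (simp add: SL2C_def spin_char_eq_cheb)
      moreover have "cmod (cheb n (trace (A ** f h))) \<le> (cmod (trace (A ** f h)) + 1) ^ n"
        by (rule norm_cheb_le)
      moreover have "(cmod (trace (A ** f h)) + 1) ^ n \<le> (\<bar>K\<bar> + 1) ^ n"
        using K[OF h] by (intro power_mono) auto
      ultimately show ?thesis
        using heat_coeff_pos[of t n] by (simp add: norm_mult)
    qed
    show "continuous_on SU2 (\<lambda>h. of_real (heat_coeff t n) * spin_char n (A ** f h))" for n
      unfolding spin_char_def by (intro continuous_intros f)
  qed
qed

text \<open>The two sums leave the integral one after the other, and orthogonality keeps the
  diagonal. Taking \<open>B\<close> as \<open>dagger g\<close> yields inner products, as
  \<open>matrix_inv g\<close> the transform.\<close>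

lemma heat_pairing:
  assumes t: "t > 0" and A: "A \<in> SL2C" and B: "B \<in> SL2C"
  shows "(\<integral>h. (\<Sum>n. of_real (heat_coeff t n) * spin_char n (A ** dagger h)) *
      (\<Sum>n. of_real (heat_coeff t n) * spin_char n (B ** h)) \<partial>\<mu>) = heat_series t (trace (A ** B))"
proof -
  define a where "a n h = of_real (heat_coeff t n) * spin_char n (A ** dagger h)" for n h
  define b where "b n h = of_real (heat_coeff t n) * spin_char n (B ** h)" for n h
  obtain \<alpha> where \<alpha>: "summable \<alpha>" "\<And>n h. h \<in> SU2 \<Longrightarrow> cmod (a n h) \<le> \<alpha> n" "\<And>n. continuous_on SU2 (a n)"
    using heat_series_bound[OF t A continuous_on_dagger[OF continuous_on_id] dagger_image_SU2]
    unfolding a_def by blast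
  obtain \<beta> where \<beta>: "summable \<beta>" "\<And>n h. h \<in> SU2 \<Longrightarrow> cmod (b n h) \<le> \<beta> n" "\<And>n. continuous_on SU2 (b n)"
    using heat_series_bound[OF t B, of "\<lambda>h. h"] SU2_subset_SL2C
    unfolding b_def by (auto intro: continuous_intros)
  have bm: "(\<lambda>h. \<Sum>n. b n h) \<in> borel_measurable \<mu>"
    by (intro borel_measurable_suminf borel_measurable_haar[OF haar] \<beta>)
  have bb: "cmod (\<Sum>n. b n h) \<le> suminf \<beta>" if "h \<in> SU2" for h
    using \<beta>(2)[OF that] by (rule norm_suminf_le[OF _ \<beta>(1)])
  have ab: "(\<integral>h. b m h * a n h \<partial>\<mu>) = (if m = n then of_real ((heat_coeff t m)\<^sup>2 / real (m + 1)) * spin_char m (A ** B) else 0)" for m n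
  proof -
    have "(\<integral>h. b m h * a n h \<partial>\<mu>) = of_real (heat_coeff t m * heat_coeff t n) *
        (\<integral>h. spin_char n (A ** dagger h) * spin_char m (B ** h) \<partial>\<mu>)"
      unfolding a_def b_def integral_mult_right_zero[symmetric]
      by (intro Bochner_Integration.integral_cong refl) simp
    then show ?thesis
      unfolding spin_char_convolution[OF haar] by (simp add: power2_eq_square)
  qed
  have "(\<integral>h. (\<Sum>n. a n h) * (\<Sum>n. b n h) \<partial>\<mu>) = (\<Sum>n. \<integral>h. a n h * (\<Sum>m. b m h) \<partial>\<mu>)"
    by (rule integral_suminf_haar[OF \<alpha>(3,2,1) bm bb])
  also have "(\<lambda>n. \<integral>h. a n h * (\<Sum>m. b m h) \<partial>\<mu>) = (\<lambda>n. of_real ((heat_coeff t n)\<^sup>2 / real (n + 1)) * spin_char n (A ** B))"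
  proof
    fix n
    have "(\<integral>h. a n h * (\<Sum>m. b m h) \<partial>\<mu>) = (\<integral>h. (\<Sum>m. b m h) * a n h \<partial>\<mu>)"
      by (simp only: mult.commute)
    also have "\<dots> = (\<Sum>m. \<integral>h. b m h * a n h \<partial>\<mu>)"
      by (rule integral_suminf_haar[OF \<beta>(3,2,1) borel_measurable_haar[OF haar \<alpha>(3)] \<alpha>(2)])
    also have "\<dots> = of_real ((heat_coeff t n)\<^sup>2 / real (n + 1)) * spin_char n (A ** B)"
      unfolding ab using sums_single[of n "\<lambda>m. of_real ((heat_coeff t m)\<^sup>2 / real (m + 1)) * spin_char m (A ** B)"]
      by (rule sums_unique[symmetric])
    finally show "(\<integral>h. a n h * (\<Sum>m. b m h) \<partial>\<mu>) = of_real ((heat_coeff t n)\<^sup>2 / real (n + 1)) * spin_char n (A ** B)" .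
  qed
  also have "(\<Sum>n. of_real ((heat_coeff t n)\<^sup>2 / real (n + 1)) * spin_char n (A ** B)) = heat_series t (trace (A ** B))"
    using SL2C_mult[OF A B] by (simp add: heat_series_def SL2C_def spin_char_eq_cheb)
  finally show ?thesis by (simp add: a_def b_def)
qed

lemma coherent_state_measurable_bounded:
  assumes t: "t > 0" and g: "g \<in> SL2C"
  shows "coherent_state t g \<in> borel_measurable \<mu>" "\<exists>C. \<forall>h\<in>SU2. cmod (coherent_state t g h) \<le> C"
proof -
  define a where "a n h = of_real (heat_coeff t n) * spin_char n (g ** dagger h)" for n h
  obtain \<alpha> where \<alpha>: "summable \<alpha>" "\<And>n h. h \<in> SU2 \<Longrightarrow> cmod (a n h) \<le> \<alpha> n" "\<And>n. continuous_on SU2 (a n)"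
    using heat_series_bound[OF t g continuous_on_dagger[OF continuous_on_id] dagger_image_SU2]
    unfolding a_def by blast
  have eq: "coherent_state t g h = (\<Sum>n. a n h)" if "h \<in> SU2" for h
    using coherent_state_SU2(1)[OF t g that] by (simp add: a_def)
  have "(\<lambda>h. \<Sum>n. a n h) \<in> borel_measurable \<mu>"
    by (intro borel_measurable_suminf borel_measurable_haar[OF haar] \<alpha>)
  then show "coherent_state t g \<in> borel_measurable \<mu>"
    by (subst measurable_cong[OF eq]) (simp_all add: space_haar[OF haar])
  have "cmod (coherent_state t g h) \<le> suminf \<alpha>" if "h \<in> SU2" for h
    unfolding eq[OF that] using \<alpha>(2)[OF that] by (rule norm_suminf_le[OF _ \<alpha>(1)])
  then show "\<exists>C. \<forall>h\<in>SU2. cmod (coherent_state t g h) \<le> C" by blast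
qed

lemma inner_coherent_states:
  assumes t: "t > 0" and g: "g \<in> SL2C" and g': "g' \<in> SL2C"
  shows "L2_inner \<mu> (coherent_state t g) (coherent_state t g') = heat_series t (trace (g' ** dagger g))"
proof -
  have "L2_inner \<mu> (coherent_state t g) (coherent_state t g') =
    (\<integral>h. (\<Sum>n. of_real (heat_coeff t n) * spin_char n (g' ** dagger h)) *
      (\<Sum>n. of_real (heat_coeff t n) * spin_char n (dagger g ** h)) \<partial>\<mu>)"
    unfolding L2_inner_def
    by (intro Bochner_Integration.integral_cong refl)
       (simp add: space_haar[OF haar] coherent_state_SU2(3)[OF t g] coherent_state_SU2(1)[OF t g'] mult.commute)
  also have "\<dots> = heat_series t (trace (g' ** dagger g))"
    by (rule heat_pairing[OF t g' dagger_SL2C[OF g]])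
  finally show ?thesis .
qed

lemma cs_transform_coherent_state:
  assumes t: "t > 0" and g: "g \<in> SL2C" and g': "g' \<in> SL2C"
  shows "cs_transform \<mu> t (coherent_state t g) g' = heat_series t (trace (g' ** matrix_inv g))"
proof -
  have "cs_transform \<mu> t (coherent_state t g) g' =
    (\<integral>h. (\<Sum>n. of_real (heat_coeff t n) * spin_char n (g' ** dagger h)) *
      (\<Sum>n. of_real (heat_coeff t n) * spin_char n (matrix_inv g ** h)) \<partial>\<mu>)"
    unfolding cs_transform_def L2_inner_def complex_cnj_cnj
    by (intro Bochner_Integration.integral_cong refl)
       (simp only: space_haar[OF haar] coherent_state_SU2(2)[OF t g] coherent_state_SU2(1)[OF t g'])
  also have "\<dots> = heat_series t (trace (g' ** matrix_inv g))"
    by (rule heat_pairing[OF t g' matrix_inv_in_SL2C[OF g]])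
  finally show ?thesis .
qed

text \<open>\<open>involution g' ** matrix_inv g\<close> is the adjoint of the inverse of
  \<open>g' ** dagger g\<close>, and inversion preserves traces in SL(2, C); this is what the
  involution in the theorem achieves.\<close>

lemma cs_transform_eq_inner:
  assumes t: "t > 0" and g: "g \<in> SL2C" and g': "g' \<in> SL2C"
  shows "cmod (cs_transform \<mu> t (coherent_state t g) (involution g')) =
    cmod (L2_inner \<mu> (coherent_state t g) (coherent_state t g'))"
proof -
  have "trace (involution g' ** matrix_inv g) = cnj (trace (g' ** dagger g))"
    unfolding involution_def matrix_inv_SL2C[OF g] matrix_inv_SL2C[OF g']
    by (simp add: trace2 mult_component2 algebra_simps)
  then show ?thesis
    by (simp add: cs_transform_coherent_state[OF t g involution_SL2C(1)[OF g']]
        inner_coherent_states[OF t g g'] cnj_heat_series[OF t])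
qed

lemma norm_coherent_state:
  assumes t: "t > 0" and g: "g \<in> SL2C"
  defines "p \<equiv> norm (momentum g)"
  shows "(L2_norm \<mu> (coherent_state t g))\<^sup>2 * sinhc p =
    exp (t / 4) * (\<Sum>m. (real m)\<^sup>2 * exp (- (t / 4) * (real m)\<^sup>2) * sinhc (real m * p))"
proof -
  have "complex_of_real ((L2_norm \<mu> (coherent_state t g))\<^sup>2) =
      complex_of_real (\<integral>h. (cmod (coherent_state t g h))\<^sup>2 \<partial>\<mu>)"
    unfolding L2_norm_def by simp
  also have "\<dots> = L2_inner \<mu> (coherent_state t g) (coherent_state t g)"
    unfolding L2_inner_def integral_complex_of_real[symmetric] complex_norm_square by (simp only: mult.commute)
  also have "\<dots> = heat_series t (of_real (2 * cosh p))"
    unfolding inner_coherent_states[OF t g g] trace_gram[OF g] p_def ..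
  finally have "complex_of_real ((L2_norm \<mu> (coherent_state t g))\<^sup>2 * sinhc p) =
      heat_series t (of_real (2 * cosh p)) * of_real (sinhc p)"
    by (simp only: of_real_mult)
  then show ?thesis
    unfolding heat_series_cosh[OF t] by (simp only: of_real_eq_iff)
qed

text \<open>Cauchy-Schwarz, obtained by integrating the weighted inequality 2 x y \<le> \<alpha> x^2
  + y^2 / \<alpha>.\<close>

lemma overlap_le_1:
  assumes t: "t > 0" and g: "g \<in> SL2C" and g': "g' \<in> SL2C"
  shows "overlap \<mu> t g g' \<le> 1"
proof -
  let ?f = "coherent_state t g" and ?h = "coherent_state t g'"
  define X where "X = (L2_norm \<mu> ?f)\<^sup>2"
  define Y where "Y = (L2_norm \<mu> ?h)\<^sup>2"
  have X: "X = (\<integral>h. (cmod (?f h))\<^sup>2 \<partial>\<mu>)" and Y: "Y = (\<integral>h. (cmod (?h h))\<^sup>2 \<partial>\<mu>)"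
    unfolding X_def Y_def L2_norm_def by simp_all
  have nonneg: "X \<ge> 0" "Y \<ge> 0" by (simp_all add: X_def Y_def)
  show ?thesis
  proof (cases "X = 0 \<or> Y = 0")
    case True
    \<comment> \<open>Division by 0 makes the overlap 0.\<close>
    then show ?thesis by (auto simp: overlap_def X_def Y_def)
  next
    case False
    then have pos: "X > 0" "Y > 0" using nonneg by auto
    obtain C where C: "\<And>h. h \<in> SU2 \<Longrightarrow> cmod (?f h) \<le> C"
      using coherent_state_measurable_bounded(2)[OF t g] by blast
    obtain D where D: "\<And>h. h \<in> SU2 \<Longrightarrow> cmod (?h h) \<le> D"
      using coherent_state_measurable_bounded(2)[OF t g'] by blast
    have meas: "?f \<in> borel_measurable \<mu>" "?h \<in> borel_measurable \<mu>"
      by (intro coherent_state_measurable_bounded t g g')+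
    have intf: "integrable \<mu> (\<lambda>h. (cmod (?f h))\<^sup>2)"
      by (rule integrable_haar_bounded[OF haar, where B = "C\<^sup>2"]) (use meas C in \<open>auto intro: power_mono\<close>)
    have inth: "integrable \<mu> (\<lambda>h. (cmod (?h h))\<^sup>2)"
      by (rule integrable_haar_bounded[OF haar, where B = "D\<^sup>2"]) (use meas D in \<open>auto intro: power_mono\<close>)
    \<comment> \<open>The weight that balances the two terms: \<alpha> X = Y / \<alpha>.\<close>
    define \<alpha> where "\<alpha> = sqrt (Y / X)"
    have \<alpha>: "\<alpha> > 0" using pos by (simp add: \<alpha>_def)
    have "cmod (L2_inner \<mu> ?f ?h) \<le> (\<integral>h. cmod (cnj (?f h) * ?h h) \<partial>\<mu>)"
      unfolding L2_inner_def by (rule integral_norm_bound)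
    also have "\<dots> \<le> (\<integral>h. \<alpha> / 2 * (cmod (?f h))\<^sup>2 + 1 / (2 * \<alpha>) * (cmod (?h h))\<^sup>2 \<partial>\<mu>)"
    proof (rule integral_mono')
      show "integrable \<mu> (\<lambda>h. \<alpha> / 2 * (cmod (?f h))\<^sup>2 + 1 / (2 * \<alpha>) * (cmod (?h h))\<^sup>2)"
        using intf inth by (intro Bochner_Integration.integrable_add integrable_mult_right) auto
      show "cmod (cnj (?f h) * ?h h) \<le> \<alpha> / 2 * (cmod (?f h))\<^sup>2 + 1 / (2 * \<alpha>) * (cmod (?h h))\<^sup>2" for h
      proof -
        have "0 \<le> (\<alpha> * cmod (?f h) - cmod (?h h))\<^sup>2" by simp
        then show ?thesis
          using \<alpha> by (simp add: norm_mult power2_eq_square field_simps)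
      qed
    qed (use \<alpha> in \<open>auto intro!: add_nonneg_nonneg\<close>)
    also have "\<dots> = \<alpha> / 2 * X + 1 / (2 * \<alpha>) * Y"
      unfolding X Y using intf inth by simp
    also have "\<dots> = \<alpha> * X"
    proof -
      have "Y = \<alpha>\<^sup>2 * X" using pos by (simp add: \<alpha>_def)
      then show ?thesis using \<alpha> by (simp add: power2_eq_square field_simps)
    qed
    finally have "(cmod (L2_inner \<mu> ?f ?h))\<^sup>2 \<le> (\<alpha> * X)\<^sup>2"
      by (intro power_mono) auto
    also have "\<dots> = X * Y"
    proof -
      have "\<alpha>\<^sup>2 = Y / X" using pos by (simp add: \<alpha>_def)
      then have "(\<alpha> * X)\<^sup>2 = Y / X * X\<^sup>2" by (simp only: power_mult_distrib)
      then show ?thesis using pos by (simp add: power2_eq_square)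
    qed
    finally show ?thesis
      using pos by (simp add: overlap_def X_def[symmetric] Y_def[symmetric])
  qed
qed

end

text \<open>At s = t / 4 the factors exp (t / 4), 1 / sinhc p and exp (p^2 / t) of the squared norm
  meet their reciprocals in \<open>nu\<close>, and the error exponent pi^2 / (2 s) becomes 2 pi^2 /
  t.\<close>

lemma nu_norm_approx:
  assumes haar: "normalized_Haar_SU2 \<mu>" and t: "0 < t" "t \<le> 1" and g: "g \<in> SL2C"
  shows "\<bar>nu t g * (L2_norm \<mu> (coherent_state t g))\<^sup>2 * (pi * t ^ 3 / 2) - 1\<bar> \<le> 12 * exp (- (2 * pi\<^sup>2) / t)"
proof -
  define p where "p = norm (momentum g)"
  define N where "N = (L2_norm \<mu> (coherent_state t g))\<^sup>2"
  define K where "K = sqrt (pi / (t / 4)) / (4 * (t / 4)) * exp (p\<^sup>2 / (4 * (t / 4)))"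
  define Q where "Q = (\<Sum>m. (real m)\<^sup>2 * exp (- (t / 4) * (real m)\<^sup>2) * sinhc (real m * p))"
  have K: "K > 0" using t by (simp add: K_def)
  have N: "N * sinhc p = exp (t / 4) * Q"
    using norm_coherent_state[OF haar t(1) g] by (simp add: N_def Q_def p_def)
  have e: "- (pi\<^sup>2 / (2 * (t / 4))) = - (2 * pi\<^sup>2) / t" by simp
  have Q: "\<bar>Q - K\<bar> \<le> 12 * exp (- (2 * pi\<^sup>2) / t) * K"
    using gauss_sinhc_sum_approx[of "t / 4" p] t unfolding e Q_def K_def by simp
  \<comment> \<open>All powers of t and pi cancel; this identity singles out the factor pi t^3 /
    2.\<close>
  have "2 * sqrt 2 / (2 * pi * t) powr (3 / 2) * (pi * t ^ 3 / 2) * (sqrt (pi / (t / 4)) / (4 * (t / 4))) = 1"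
  proof -
    have powr32: "x powr (3 / 2) = x * sqrt x" if "x > 0" for x :: real
    proof -
      have "x powr (3 / 2) = x powr (1 + 1 / 2)" by simp
      also have "\<dots> = x * sqrt x"
        using that by (simp only: powr_add powr_half_sqrt) simp
      finally show ?thesis .
    qed
    have s: "sqrt (pi / (t / 4)) = 2 * sqrt pi / sqrt t"
      using t by (simp add: real_sqrt_divide real_sqrt_mult)
    have "sqrt t * sqrt t = t" using t by simp
    then show ?thesis
      unfolding s using t by (simp add: powr32 real_sqrt_mult field_simps power3_eq_cube)
  qed
  moreover have "exp (- p\<^sup>2 / t) * K = sqrt (pi / (t / 4)) / (4 * (t / 4))"
    by (simp add: K_def flip: exp_add)
  ultimately have one: "2 * sqrt 2 / (2 * pi * t) powr (3 / 2) * (pi * t ^ 3 / 2) * (exp (- p\<^sup>2 / t) * K) = 1"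
    by (simp only:)
  have "nu t g * N * (pi * t ^ 3 / 2) =
      2 * sqrt 2 / (2 * pi * t) powr (3 / 2) * (pi * t ^ 3 / 2) * exp (- p\<^sup>2 / t) * (exp (- t / 4) * (N * sinhc p))"
    by (simp add: nu_def Let_def p_def mult_ac)
  also have "exp (- t / 4) * (N * sinhc p) = Q"
    unfolding N by (simp add: mult.assoc[symmetric] flip: exp_add)
  also have "2 * sqrt 2 / (2 * pi * t) powr (3 / 2) * (pi * t ^ 3 / 2) * exp (- p\<^sup>2 / t) * Q =
      (2 * sqrt 2 / (2 * pi * t) powr (3 / 2) * (pi * t ^ 3 / 2) * (exp (- p\<^sup>2 / t) * K)) * (Q / K)"
    using K by simp
  finally have eq: "nu t g * N * (pi * t ^ 3 / 2) - 1 = (Q - K) / K"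
    unfolding one using K by (simp add: field_simps)
  show ?thesis
    unfolding N_def[symmetric] eq using Q K by (simp add: abs_divide divide_le_eq)
qed

text \<open>The bound relative to the overlap is the primary one; the absolute bound follows because
  the overlap is at most 1.\<close>

theorem theorem4p7:
  fixes \<mu> :: "(complex^2^2) measure"
  assumes "normalized_Haar_SU2 \<mu>"
  shows "\<exists>C>0. \<exists>c>0. \<forall>\<^sub>F t in at_right (0::real). \<forall>g\<in>SL2C. \<forall>g'\<in>SL2C.
    \<bar>overlap \<mu> t g g' - phase_density \<mu> t g (involution g') * (pi * t^3 / 2)\<bar>
      \<le> C * exp (- c / t) \<and>
    \<bar>overlap \<mu> t g g' - phase_density \<mu> t g (involution g') * (pi * t^3 / 2)\<bar>
      \<le> C * exp (- c / t) * overlap \<mu> t g g'"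
proof -
  have bound: "\<bar>overlap \<mu> t g g' - phase_density \<mu> t g (involution g') * (pi * t^3 / 2)\<bar>
      \<le> 12 * exp (- (2 * pi\<^sup>2) / t) * overlap \<mu> t g g'"
    if t: "0 < t" "t < 1" and g: "g \<in> SL2C" "g' \<in> SL2C" for t g g'
  proof -
    define z where "z = (cmod (L2_inner \<mu> (coherent_state t g) (coherent_state t g')))\<^sup>2"
    define X where "X = (L2_norm \<mu> (coherent_state t g))\<^sup>2"
    define Y where "Y = (L2_norm \<mu> (coherent_state t g'))\<^sup>2"
    define d where "d = nu t g' * Y * (pi * t ^ 3 / 2) - 1"
    have d: "\<bar>d\<bar> \<le> 12 * exp (- (2 * pi\<^sup>2) / t)"
      using nu_norm_approx[OF assms, of t g'] t g by (simp add: d_def Y_def)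
    \<comment> \<open>A vanishing norm would mean d = -1, but 12 exp (- 2 pi^2 / t) is below 1 for t
      < 1.\<close>
    have "Y \<noteq> 0"
    proof
      assume "Y = 0"
      then have "1 \<le> 12 * exp (- (2 * pi\<^sup>2) / t)" using d by (simp add: d_def)
      moreover have "12 < exp (2 * pi\<^sup>2 / t)"
      proof -
        have "3\<^sup>2 \<le> pi\<^sup>2" using pi_gt3 by (intro power_mono) auto
        then have "18 \<le> 2 * pi\<^sup>2" by simp
        also have "\<dots> \<le> 2 * pi\<^sup>2 / t" using t by (simp add: field_simps)
        finally show ?thesis using exp_ge_add_one_self[of "2 * pi\<^sup>2 / t"] by linarith
      qed
      ultimately show False by (simp add: exp_minus field_simps)
    qed
    have "nu t (involution g') = nu t g'"
      by (simp add: nu_def involution_SL2C(2)[OF g(2)])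
    then have ph: "phase_density \<mu> t g (involution g') = nu t g' * z / X"
      by (simp add: phase_density_def z_def X_def cs_transform_eq_inner[OF assms t(1) g])
    have ov: "overlap \<mu> t g g' = z / (X * Y)"
      by (simp add: overlap_def z_def X_def Y_def)
    \<comment> \<open>If X = 0, both quotients are 0 by the convention for division.\<close>
    have "overlap \<mu> t g g' - phase_density \<mu> t g (involution g') * (pi * t^3 / 2) =
        - d * overlap \<mu> t g g'"
      unfolding ph ov using \<open>Y \<noteq> 0\<close> by (cases "X = 0") (simp_all add: d_def field_simps)
    moreover have "overlap \<mu> t g g' \<ge> 0"
      by (simp add: overlap_def)
    ultimately show ?thesis
      using d by (simp add: abs_mult mult_right_mono)
  qed
  have "\<forall>\<^sub>F t in at_right (0::real). 0 < t \<and> t < 1"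
    using eventually_at_right_less[of "0::real"] eventually_at_right_field[of "\<lambda>t. t < 1" "0::real"]
    by (auto intro: eventually_conj simp: exI[of _ 1])
  then have "\<forall>\<^sub>F t in at_right (0::real). \<forall>g\<in>SL2C. \<forall>g'\<in>SL2C.
    \<bar>overlap \<mu> t g g' - phase_density \<mu> t g (involution g') * (pi * t^3 / 2)\<bar>
      \<le> 12 * exp (- (2 * pi\<^sup>2) / t) \<and>
    \<bar>overlap \<mu> t g g' - phase_density \<mu> t g (involution g') * (pi * t^3 / 2)\<bar>
      \<le> 12 * exp (- (2 * pi\<^sup>2) / t) * overlap \<mu> t g g'"
  proof eventually_elim
    case (elim t)
    show ?case
    proof (intro ballI conjI)
      fix g g' assume g: "g \<in> SL2C" "g' \<in> SL2C"
      show 1: "\<bar>overlap \<mu> t g g' - phase_density \<mu> t g (involution g') * (pi * t^3 / 2)\<bar>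
        \<le> 12 * exp (- (2 * pi\<^sup>2) / t) * overlap \<mu> t g g'"
        using bound elim g by blast
      also have "\<dots> \<le> 12 * exp (- (2 * pi\<^sup>2) / t)"
        using overlap_le_1[OF assms, of t g g'] elim g by (intro mult_left_le) auto
      finally show "\<bar>overlap \<mu> t g g' - phase_density \<mu> t g (involution g') * (pi * t^3 / 2)\<bar>
        \<le> 12 * exp (- (2 * pi\<^sup>2) / t)" .
    qed
  qed
  then show ?thesis
    by (intro exI[of _ 12] conjI exI[of _ "2 * pi\<^sup>2"]) auto
qed

end
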